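(* Let $\mathcal{G}=(G^0,\mathcal{G}^1,r,s)$ be an ultragraph with at least one edge, let $R$ be a nonzero unital commutative ring, and let $\mathbb{F}$ be the free group generated by $\mathcal{G}^1$. Then $L_R(\mathcal{G})$, with its $\mathbb{F}$-grading, is strongly $\mathbb{F}$-graded if and only if $\mathcal{G}$ has only one edge $e$, and this edge satisfies $r(e)=\{s(e)\}$.
   Context: An ultragraph $\mathcal{G}=(G^0,\mathcal{G}^1,r,s)$ consists of two countable sets $G^0$ (vertices) and $\mathcal{G}^1$ (edges), a map $s:\mathcal{G}^1\to G^0$ and a map $r:\mathcal{G}^1\to P(G^0)\setminus\{\emptyset\}$, where $P(G^0)$ is the power set of $G^0$. $\mathcal{G}^0$ is the smallest subset of $P(G^0)$ that contains $\{v\}$ for all $v\in G^0$, contains $r(e)$ for all $e\in\mathcal{G}^1$, and is closed under finite unions and non-empty finite intersections. For a unital commutative ring $R$, $L_R(\mathcal{G})$ is the universal $R$-algebra with generators $\{s_e,s_e^*:e\in\mathcal{G}^1\}\cup\{p_A:A\in\mathcal{G}^0\}$ and relations: (1) $p_\emptyset=0$, $p_Ap_B=p_{A\cap B}$, $p_{A\cup B}=p_A+p_B-p_{A\cap B}$ for all $A,B\in\mathcal{G}^0$; (2) $p_{s(e)}s_e=s_ep_{r(e)}=s_e$ and $p_{r(e)}s_e^*=s_e^*p_{s(e)}=s_e^*$ for all $e\in\mathcal{G}^1$; (3) $s_e^*s_f=\delta_{e,f}p_{r(e)}$ for all $e,f\in\mathcal{G}^1$; (4) $p_v=\sum_{s(e)=v}s_es_e^*$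 whenever $0<|s^{-1}(v)|<\infty$. Here $p_v$ means $p_{\{v\}}$. A finite path is either an element of $\mathcal{G}^0$ (of length $0$) or a sequence of edges $e_1\cdots e_n$ (of length $n$) with $s(e_{i+1})\in r(e_i)$ for $1\le i<n$. For $\alpha=e_1\cdots e_n$, $s_\alpha=s_{e_1}\cdots s_{e_n}$ and $s_\alpha^*=s_{e_n}^*\cdots s_{e_1}^*$; for $A\in\mathcal{G}^0$, $s_A=s_A^*=p_A$. The $\mathbb{F}$-grading on $L_R(\mathcal{G})$ is the one in which each $p_A$ is homogeneous of degree the neutral element, each $s_e$ is homogeneous of degree $e$, and each $s_e^*$ is homogeneous of degree $e^{-1}$: the component of degree $t\in\mathbb{F}$ is the $R$-span of the elements $s_\alpha p_As_\beta^*$ with $A\in\mathcal{G}^0$ and $\alpha,\beta$ finite paths such that $\alpha\beta^{-1}=t$ in $\mathbb{F}$ (paths of length zero being read as the neutral element). A grading $\{T_g\}_{g\in\Gamma}$ of a ring by a group $\Gamma$ is strong if $T_gT_h=T_{gh}$ for all $g,h\in\Gamma$, where $T_gT_h$ denotes the set of finite sums of products.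
   Formalization: The right-hand side also requires that every vertex be the source of an edge or lie in the range of an edge; without this the "if" direction fails, e.g. for one loop at v plus an isolated vertex w. *)

theory Defs
  imports "HOL-Library.Countable_Set" "HOL-Library.Poly_Mapping" "HOL-Algebra.Module" "HOL-Algebra.QuotRing"
begin

section \<open>Ultragraphs\<close>

record ('v, 'e) ultragraph =
  verts :: "'v set"
  edges :: "'e set"
  rng   :: "'e \<Rightarrow> 'v set"
  src   :: "'e \<Rightarrow> 'v"

definition ultragraph :: "('v, 'e) ultragraph \<Rightarrow> bool" where
  "ultragraph G \<longleftrightarrow>
     countable (verts G) \<and> countable (edges G) \<and>
     (\<forall>e\<in>edges G. src G e \<in> verts G \<and> rng G e \<subseteq> verts G \<and> rng G e \<noteq> {})"

text \<open>The family written \<open>\<G>\<^sup>0\<close>. Finite unions include the empty one, so that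
  \<open>p\<^sub>\<emptyset>\<close> makes sense; only the empty intersection is left out.\<close>

inductive_set gverts :: "('v, 'e) ultragraph \<Rightarrow> 'v set set" for G where
  singleton: "v \<in> verts G \<Longrightarrow> {v} \<in> gverts G"
| rng: "e \<in> edges G \<Longrightarrow> rng G e \<in> gverts G"
| empty: "{} \<in> gverts G"
| Un: "A \<in> gverts G \<Longrightarrow> B \<in> gverts G \<Longrightarrow> A \<union> B \<in> gverts G"
| Int: "A \<in> gverts G \<Longrightarrow> B \<in> gverts G \<Longrightarrow> A \<inter> B \<in> gverts G"


section \<open>Free groups\<close>

text \<open>Reduced words over the letters \<open>(True, x)\<close>, standing for \<open>x\<close>, and \<open>(False, x)\<close>,
  standing for \<open>x\<inverse>\<close>.\<close>

fun push :: "bool \<times> 'a \<Rightarrow> (bool \<times> 'a) list \<Rightarrow> (bool \<times> 'a) list" where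
  "push a [] = [a]"
| "push a (b # w) = (if snd a = snd b \<and> fst a \<noteq> fst b then w else a # b # w)"

fun reduced :: "(bool \<times> 'a) list \<Rightarrow> bool" where
  "reduced (a # b # w) \<longleftrightarrow> \<not> (snd a = snd b \<and> fst a \<noteq> fst b) \<and> reduced (b # w)"
| "reduced _ \<longleftrightarrow> True"

definition free_group :: "'a set \<Rightarrow> (bool \<times> 'a) list monoid" where
  "free_group X =
     \<lparr>carrier = {w. reduced w \<and> set w \<subseteq> UNIV \<times> X}, mult = foldr push, one = []\<rparr>"

lemma reduced_tl: "reduced (a # w) \<Longrightarrow> reduced w"
  by (cases w) auto

lemma reduced_push: "reduced w \<Longrightarrow> reduced (push a w)"
  by (cases w) (auto dest: reduced_tl)

lemma set_push: "set (push a w) \<subseteq> insert a (set w)"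
  by (cases w) auto

lemma push_cancel: "reduced w \<Longrightarrow> push (b, x) (push (\<not> b, x) w) = w"
proof (induction w)
  case (Cons c w)
  then show ?case by (cases w; cases c) auto
qed auto

lemma reduced_foldr_push: "reduced w \<Longrightarrow> reduced (foldr push u w)"
  by (induction u) (auto simp: reduced_push)

lemma set_foldr_push: "set (foldr push u w) \<subseteq> set u \<union> set w"
  by (induction u) (use set_push in fastforce)+

lemma foldr_push_push:
  assumes "reduced u" "reduced w"
  shows "foldr push (push a u) w = push a (foldr push u w)"
proof (cases u)
  case (Cons b u')
  then show ?thesis
    using assms push_cancel[of "foldr push u' w" "fst a" "snd a"] reduced_foldr_push[of w u']
    by (cases a; cases b) auto
qed auto

lemma foldr_push_assoc:
  assumes "reduced v" "reduced w"
  shows "foldr push (foldr push u v) w = foldr push u (foldr push v w)"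
  by (induction u) (simp_all add: assms foldr_push_push reduced_foldr_push)

lemma foldr_push_Nil: "reduced w \<Longrightarrow> foldr push w [] = w"
proof (induction w)
  case (Cons a w)
  then have "foldr push w [] = w" by (auto dest: reduced_tl)
  with Cons.prems show ?case by (cases w) auto
qed auto

lemma foldr_push_inverse:
  "reduced w \<Longrightarrow> foldr push (map (\<lambda>(b, x). (\<not> b, x)) (rev u)) (foldr push u w) = w"
proof (induction u)
  case (Cons a u)
  then show ?case
    using push_cancel[of "foldr push u w" "\<not> fst a" "snd a"]
    by (auto simp: reduced_foldr_push split: prod.split)
qed auto

lemma group_free_group: "group (free_group X)"
proof (rule groupI)
  fix u assume u: "u \<in> carrier (free_group X)"
  let ?i = "foldr push (map (\<lambda>(b, x). (\<not> b, x)) (rev u)) []"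
  have "set ?i \<subseteq> UNIV \<times> X"
    using u set_foldr_push[of "map (\<lambda>(b, x). (\<not> b, x)) (rev u)" "[]"]
    by (fastforce simp: free_group_def)
  moreover have "foldr push ?i u = []"
    using foldr_push_inverse[of "[]" u] foldr_push_assoc[of "[]" u] u
    by (simp add: free_group_def foldr_push_Nil)
  ultimately show "\<exists>v\<in>carrier (free_group X). v \<otimes>\<^bsub>free_group X\<^esub> u = \<one>\<^bsub>free_group X\<^esub>"
    by (intro bexI[of _ ?i]) (simp_all add: free_group_def reduced_foldr_push)
qed (use set_foldr_push in
    \<open>fastforce simp: free_group_def reduced_foldr_push foldr_push_assoc\<close>)+


section \<open>Algebras, gradings\<close>

text \<open>A not necessarily unital algebra over a commutative ring \<open>'r\<close> is represented by a
  record of type \<open>('r, 'a) module\<close>, whose field \<open>one\<close> is then meaningless.\<close>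

inductive_set lspan :: "('r, 'a) module \<Rightarrow> 'a set \<Rightarrow> 'a set" for L X where
  zero: "\<zero>\<^bsub>L\<^esub> \<in> lspan L X"
| add: "x \<in> X \<Longrightarrow> y \<in> lspan L X \<Longrightarrow> (c \<odot>\<^bsub>L\<^esub> x) \<oplus>\<^bsub>L\<^esub> y \<in> lspan L X"

text \<open>The set \<open>XY\<close> of finite sums of products.\<close>

inductive_set sum_prods :: "('a, 'b) ring_scheme \<Rightarrow> 'a set \<Rightarrow> 'a set \<Rightarrow> 'a set" for L X Y where
  zero: "\<zero>\<^bsub>L\<^esub> \<in> sum_prods L X Y"
| add: "x \<in> X \<Longrightarrow> y \<in> Y \<Longrightarrow> z \<in> sum_prods L X Y \<Longrightarrow> (x \<otimes>\<^bsub>L\<^esub> y) \<oplus>\<^bsub>L\<^esub> z \<in> sum_prods L X Y"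

definition graded :: "('g, 'c) monoid_scheme \<Rightarrow> ('a, 'b) ring_scheme \<Rightarrow> ('g \<Rightarrow> 'a set) \<Rightarrow> bool" where
  "graded \<Gamma> L T \<longleftrightarrow>
     (\<forall>g\<in>carrier \<Gamma>. additive_subgroup (T g) L) \<and>
     (\<forall>x\<in>carrier L. \<exists>!f. f \<in> (\<Pi>\<^sub>E g\<in>carrier \<Gamma>. T g) \<and> finite {g\<in>carrier \<Gamma>. f g \<noteq> \<zero>\<^bsub>L\<^esub>} \<and>
        x = (\<Oplus>\<^bsub>L\<^esub>g\<in>{g\<in>carrier \<Gamma>. f g \<noteq> \<zero>\<^bsub>L\<^esub>}. f g)) \<and>
     (\<forall>g\<in>carrier \<Gamma>. \<forall>h\<in>carrier \<Gamma>. sum_prods L (T g) (T h) \<subseteq> T (g \<otimes>\<^bsub>\<Gamma>\<^esub> h))"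

definition strongly_graded ::
  "('g, 'c) monoid_scheme \<Rightarrow> ('a, 'b) ring_scheme \<Rightarrow> ('g \<Rightarrow> 'a set) \<Rightarrow> bool" where
  "strongly_graded \<Gamma> L T \<longleftrightarrow>
     graded \<Gamma> L T \<and>
     (\<forall>g\<in>carrier \<Gamma>. \<forall>h\<in>carrier \<Gamma>. sum_prods L (T g) (T h) = T (g \<otimes>\<^bsub>\<Gamma>\<^esub> h))"


section \<open>Free algebras\<close>

text \<open>Words as an additively written monoid, so that finitely supported functions on them
  carry the convolution product.\<close>

datatype 'a fword = FWord (letters: "'a list")

instantiation fword :: (type) monoid_add
begin

definition zero_fword :: "'a fword" where "0 = FWord []"

definition plus_fword :: "'a fword \<Rightarrow> 'a fword \<Rightarrow> 'a fword" where
  "u + v = FWord (letters u @ letters v)"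

instance by standard (auto simp: zero_fword_def plus_fword_def)

end

type_synonym ('x, 'r) fpoly = "'x fword \<Rightarrow>\<^sub>0 'r"

definition monom :: "'x list \<Rightarrow> ('x, 'r::comm_ring_1) fpoly" where
  "monom w = Poly_Mapping.single (FWord w) 1"

definition scale :: "'r \<Rightarrow> ('x, 'r::comm_ring_1) fpoly \<Rightarrow> ('x, 'r) fpoly" where
  "scale c x = Poly_Mapping.map ((*) c) x"

lemma monom_mult: "monom u * monom v = monom (u @ v)"
  by (simp add: monom_def mult_single plus_fword_def)

text \<open>The free non-unital algebra on \<open>X\<close>: only non-empty words occur.\<close>

definition free_algebra :: "'x set \<Rightarrow> ('r::comm_ring_1, ('x, 'r) fpoly) module" where
  "free_algebra X =
     \<lparr>carrier = {x. \<forall>w\<in>Poly_Mapping.keys x. letters w \<noteq> [] \<and> set (letters w) \<subseteq> X},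
      mult = (*), one = undefined, zero = 0, add = (+), smult = scale\<rparr>"

inductive_set alg_ideal :: "('r, 'a) module \<Rightarrow> 'a set \<Rightarrow> 'a set" for A S where
  gen: "x \<in> S \<Longrightarrow> x \<in> alg_ideal A S"
| zero: "\<zero>\<^bsub>A\<^esub> \<in> alg_ideal A S"
| add: "x \<in> alg_ideal A S \<Longrightarrow> y \<in> alg_ideal A S \<Longrightarrow> x \<oplus>\<^bsub>A\<^esub> y \<in> alg_ideal A S"
| smult: "x \<in> alg_ideal A S \<Longrightarrow> c \<odot>\<^bsub>A\<^esub> x \<in> alg_ideal A S"
| mult_l: "a \<in> carrier A \<Longrightarrow> x \<in> alg_ideal A S \<Longrightarrow> a \<otimes>\<^bsub>A\<^esub> x \<in> alg_ideal A S"
| mult_r: "a \<in> carrier A \<Longrightarrow> x \<in> alg_ideal A S \<Longrightarrow> x \<otimes>\<^bsub>A\<^esub> a \<in> alg_ideal A S"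

text \<open>The library's \<^const>\<open>FactRing\<close> has no scalar multiplication.\<close>

definition quot_algebra :: "('r, 'a) module \<Rightarrow> 'a set \<Rightarrow> ('r, 'a set) module" where
  "quot_algebra A I =
     \<lparr>carrier = a_rcosets\<^bsub>A\<^esub> I, mult = rcoset_mult A I, one = undefined, zero = I, add = set_add A,
      smult = (\<lambda>c X. \<Union>x\<in>X. I +>\<^bsub>A\<^esub> (c \<odot>\<^bsub>A\<^esub> x))\<rparr>"


lemma free_algebra_simps [simp]:
  "mult (free_algebra X) = (*)" "add (free_algebra X) = (+)" "zero (free_algebra X) = 0"
  "smult (free_algebra X) = scale"
  by (simp_all add: free_algebra_def)

lemma mem_free_algebra:
  "x \<in> carrier (free_algebra X) \<longleftrightarrow>
     (\<forall>w\<in>Poly_Mapping.keys x. letters w \<noteq> [] \<and> set (letters w) \<subseteq> X)"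
  by (simp add: free_algebra_def)

lemma monom_closed: "w \<noteq> [] \<Longrightarrow> set w \<subseteq> X \<Longrightarrow> monom w \<in> carrier (free_algebra X)"
  by (simp add: mem_free_algebra monom_def)

lemma free_algebra_closed:
  fixes x y :: "('x, 'r::comm_ring_1) fpoly"
  assumes "x \<in> carrier (free_algebra X)"
  shows "- x \<in> carrier (free_algebra X)" and "scale c x \<in> carrier (free_algebra X)"
    and "y \<in> carrier (free_algebra X) \<Longrightarrow> x + y \<in> carrier (free_algebra X)"
    and "y \<in> carrier (free_algebra X) \<Longrightarrow> x * y \<in> carrier (free_algebra X)"
proof -
  show "- x \<in> carrier (free_algebra X)"
    using assms by (simp add: mem_free_algebra)
  show "scale c x \<in> carrier (free_algebra X)"
    using assms by (auto simp: mem_free_algebra scale_def in_keys_iff map.rep_eq when_def)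
  show "x + y \<in> carrier (free_algebra X)" if "y \<in> carrier (free_algebra X)"
    using assms that Poly_Mapping.keys_add[of x y] by (fastforce simp: mem_free_algebra)
  show "x * y \<in> carrier (free_algebra X)" if "y \<in> carrier (free_algebra X)"
    using assms that keys_mult[of x y] by (fastforce simp: mem_free_algebra plus_fword_def)
qed

lemma abelian_group_free_algebra: "abelian_group (free_algebra X :: ('r::comm_ring_1, _) module)"
proof (rule abelian_groupI)
  fix x assume "x \<in> carrier (free_algebra X :: ('r, _) module)"
  then show "\<exists>y\<in>carrier (free_algebra X). y \<oplus>\<^bsub>free_algebra X\<^esub> x = \<zero>\<^bsub>free_algebra X\<^esub>"
    by (intro bexI[of _ "- x"]) (simp_all add: free_algebra_closed)
qed (auto simp: free_algebra_closed(3) algebra_simps, simp add: mem_free_algebra)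

lemma alg_ideal_additive_subgroup:
  fixes I :: "('x, 'r::comm_ring_1) fpoly set" and X T
  defines "I \<equiv> alg_ideal (free_algebra X) T"
  assumes "T \<subseteq> carrier (free_algebra X)"
  shows "additive_subgroup I (free_algebra X)"
proof -
  interpret abelian_group "free_algebra X :: ('r, ('x, 'r) fpoly) module"
    by (rule abelian_group_free_algebra)
  have sub: "x \<in> carrier (free_algebra X)" if "x \<in> I" for x
    using that unfolding I_def
    by induction (use assms(2) in \<open>auto simp: free_algebra_closed mem_free_algebra[of 0]\<close>)
  have neg: "- x \<in> I" if "x \<in> I" for x
  proof -
    have "scale (- 1) x = - x"
      by (rule poly_mapping_eqI) (simp add: scale_def map.rep_eq when_def)
    then show ?thesis
      using alg_ideal.smult[of x "free_algebra X" T "- 1"] that by (simp add: I_def)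
  qed
  have inv: "inv\<^bsub>add_monoid (free_algebra X)\<^esub> x = - x" if "x \<in> I" for x
    using sub[OF that] minus_equality[of "- x" x]
    by (simp add: a_inv_def free_algebra_closed)
  show ?thesis
  proof (intro additive_subgroup.intro group.subgroupI a_group)
    show "I \<subseteq> carrier (add_monoid (free_algebra X))"
      using sub by auto
    show "I \<noteq> {}"
      using alg_ideal.zero unfolding I_def by blast
    show "inv\<^bsub>add_monoid (free_algebra X)\<^esub> x \<in> I" if "x \<in> I" for x
      by (simp only: inv[OF that] neg[OF that])
    show "x \<otimes>\<^bsub>add_monoid (free_algebra X)\<^esub> y \<in> I" if "x \<in> I" "y \<in> I" for x y
      using that alg_ideal.add[of x "free_algebra X" T y] by (simp add: I_def)
  qed
qed

lemma quot_algebra_mult: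
  fixes x y :: "('x, 'r::comm_ring_1) fpoly" and X T
  defines "I \<equiv> alg_ideal (free_algebra X) T"
  assumes T: "T \<subseteq> carrier (free_algebra X)"
    and xy: "x \<in> carrier (free_algebra X)" "y \<in> carrier (free_algebra X)"
  shows "(I +>\<^bsub>free_algebra X\<^esub> x) \<otimes>\<^bsub>quot_algebra (free_algebra X) I\<^esub> (I +>\<^bsub>free_algebra X\<^esub> y)
    = I +>\<^bsub>free_algebra X\<^esub> (x * y)"
proof -
  interpret abelian_group "free_algebra X :: ('r, ('x, 'r) fpoly) module"
    by (rule abelian_group_free_algebra)
  interpret additive_subgroup I "free_algebra X"
    unfolding I_def by (rule alg_ideal_additive_subgroup[OF T])
  have coset: "I +>\<^bsub>free_algebra X\<^esub> z = {i + z | i. i \<in> I}" for z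
    by (auto simp: a_r_coset_def r_coset_def)
  have I: "i \<in> carrier (free_algebra X)" if "i \<in> I" for i
    using a_subset that by blast
  have eq: "I +>\<^bsub>free_algebra X\<^esub> ((i + x) * (j + y)) = I +>\<^bsub>free_algebra X\<^esub> (x * y)"
    if ij: "i \<in> I" "j \<in> I" for i j
  proof -
    have "i * (j + y) \<in> I" "x * j \<in> I"
      using ij xy alg_ideal.mult_r[of "j + y" "free_algebra X" i T]
        alg_ideal.mult_l[of x "free_algebra X" j T]
      by (simp_all add: I_def[symmetric] free_algebra_closed(3) I)
    then have k: "i * (j + y) + x * j \<in> I"
      using a_closed by simp
    have "(i + x) * (j + y) = (i * (j + y) + x * j) + x * y"
      by (simp add: algebra_simps)
    then show ?thesis
      using a_repr_independence[OF _ free_algebra_closed(4)[OF xy] a_subgroup,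
          of "(i + x) * (j + y)"] k
      unfolding coset by fastforce
  qed
  have "(I +>\<^bsub>free_algebra X\<^esub> x) \<otimes>\<^bsub>quot_algebra (free_algebra X) I\<^esub> (I +>\<^bsub>free_algebra X\<^esub> y)
    = (\<Union>i\<in>I. \<Union>j\<in>I. I +>\<^bsub>free_algebra X\<^esub> ((i + x) * (j + y)))"
    by (auto simp: quot_algebra_def rcoset_mult_def coset[of x] coset[of y])
  also have "\<dots> = I +>\<^bsub>free_algebra X\<^esub> (x * y)"
    using eq zero_closed by auto
  finally show ?thesis .
qed


section \<open>Ultragraph Leavitt path algebras\<close>

text \<open>\<open>S e\<close>, \<open>Sst e\<close> and \<open>P A\<close> are the generators \<open>s\<^sub>e\<close>, \<open>s\<^sub>e\<^sup>*\<close> and \<open>p\<^sub>A\<close>.\<close>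

datatype ('v, 'e) lgen = S 'e | Sst 'e | P "'v set"

definition lgens :: "('v, 'e) ultragraph \<Rightarrow> ('v, 'e) lgen set" where
  "lgens G = S ` edges G \<union> Sst ` edges G \<union> P ` gverts G"

text \<open>A defining relation \<open>l = r\<close> is recorded as \<open>l - r\<close>.\<close>

definition lrels :: "('v, 'e) ultragraph \<Rightarrow> (('v, 'e) lgen, 'r::comm_ring_1) fpoly set" where
  "lrels G =
     {monom [P {}]} \<union>
     {monom [P A] * monom [P B] - monom [P (A \<inter> B)] | A B. A \<in> gverts G \<and> B \<in> gverts G} \<union>
     {monom [P (A \<union> B)] - (monom [P A] + monom [P B] - monom [P (A \<inter> B)]) | A B.
        A \<in> gverts G \<and> B \<in> gverts G} \<union>
     {monom [P {src G e}] * monom [S e] - monom [S e] | e. e \<in> edges G} \<union>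
     {monom [S e] * monom [P (rng G e)] - monom [S e] | e. e \<in> edges G} \<union>
     {monom [P (rng G e)] * monom [Sst e] - monom [Sst e] | e. e \<in> edges G} \<union>
     {monom [Sst e] * monom [P {src G e}] - monom [Sst e] | e. e \<in> edges G} \<union>
     {monom [Sst e] * monom [S f] - (if e = f then monom [P (rng G e)] else 0) | e f.
        e \<in> edges G \<and> f \<in> edges G} \<union>
     {monom [P {v}] - (\<Sum>e\<in>{e\<in>edges G. src G e = v}. monom [S e] * monom [Sst e]) | v.
        v \<in> verts G \<and> {e\<in>edges G. src G e = v} \<noteq> {} \<and> finite {e\<in>edges G. src G e = v}}"

definition lideal :: "('v, 'e) ultragraph \<Rightarrow> (('v, 'e) lgen, 'r::comm_ring_1) fpoly set" where
  "lideal G = alg_ideal (free_algebra (lgens G)) (lrels G)"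

type_synonym ('v, 'e, 'r) lpa = "('r, (('v, 'e) lgen, 'r) fpoly set) module"

definition leavitt :: "('v, 'e) ultragraph \<Rightarrow> ('v, 'e, 'r::comm_ring_1) lpa" where
  "leavitt G = quot_algebra (free_algebra (lgens G)) (lideal G)"

text \<open>The product in \<^const>\<open>leavitt\<close> of a non-empty word in the generators.\<close>

definition lmonom :: "('v, 'e) ultragraph \<Rightarrow> ('v, 'e) lgen list
    \<Rightarrow> (('v, 'e) lgen, 'r::comm_ring_1) fpoly set" where
  "lmonom G w = lideal G +>\<^bsub>free_algebra (lgens G)\<^esub> monom w"

lemma lrels_subset:
  fixes G :: "('v, 'e) ultragraph"
  assumes "ultragraph G"
  shows "(lrels G :: (('v, 'e) lgen, 'r::comm_ring_1) fpoly set) \<subseteq> carrier (free_algebra (lgens G))"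
proof -
  let ?A = "free_algebra (lgens G) :: ('r, (('v, 'e) lgen, 'r) fpoly) module"
  have P: "monom [P A] \<in> carrier ?A" if "A \<in> gverts G" for A
    using that by (simp add: monom_closed lgens_def)
  have S: "monom [S e] \<in> carrier ?A" "monom [Sst e] \<in> carrier ?A"
    "monom [P (rng G e)] \<in> carrier ?A" if "e \<in> edges G" for e
    using that by (simp_all add: monom_closed lgens_def gverts.rng)
  have src: "monom [P {src G e}] \<in> carrier ?A" if "e \<in> edges G" for e
    using that assms by (intro P gverts.singleton) (simp add: ultragraph_def)
  have sum: "sum h E \<in> carrier ?A" if "\<And>e. e \<in> E \<Longrightarrow> h e \<in> carrier ?A" for h and E :: "'e set"
    using that
    by (induction E rule: infinite_finite_induct)
      (simp_all add: free_algebra_closed(3), simp_all add: mem_free_algebra)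
  have minus: "x - y \<in> carrier ?A" if "x \<in> carrier ?A" "y \<in> carrier ?A" for x y
    using free_algebra_closed(3)[OF that(1) free_algebra_closed(1)[OF that(2)]] by simp
  have "0 \<in> carrier ?A"
    by (simp add: mem_free_algebra)
  then show ?thesis
    unfolding lrels_def
    by (auto intro!: minus sum P S src gverts.intros free_algebra_closed(3,4))
qed

lemma lmonom_mult:
  assumes "ultragraph G" "u \<noteq> []" "set u \<subseteq> lgens G" "v \<noteq> []" "set v \<subseteq> lgens G"
  shows "lmonom G u \<otimes>\<^bsub>leavitt G\<^esub> lmonom G v = lmonom G (u @ v)"
  using assms
  by (simp add: lmonom_def leavitt_def lideal_def quot_algebra_mult lrels_subset monom_closed
      monom_mult)

datatype ('v, 'e) path = Vtx "'v set" | Edges "'e list"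

fun fin_path :: "('v, 'e) ultragraph \<Rightarrow> ('v, 'e) path \<Rightarrow> bool" where
  "fin_path G (Vtx A) \<longleftrightarrow> A \<in> gverts G"
| "fin_path G (Edges es) \<longleftrightarrow> es \<noteq> [] \<and> set es \<subseteq> edges G \<and>
     (\<forall>i. Suc i < length es \<longrightarrow> src G (es ! Suc i) \<in> rng G (es ! i))"

text \<open>The words \<open>s\<^sub>\<alpha>\<close> and \<open>s\<^sub>\<alpha>\<^sup>*\<close>, and \<open>\<alpha>\<close> read in the free group.\<close>

fun path_word :: "('v, 'e) path \<Rightarrow> ('v, 'e) lgen list" where
  "path_word (Vtx A) = [P A]"
| "path_word (Edges es) = map S es"

fun path_word_star :: "('v, 'e) path \<Rightarrow> ('v, 'e) lgen list" where
  "path_word_star (Vtx A) = [P A]"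
| "path_word_star (Edges es) = map Sst (rev es)"

fun path_deg :: "('v, 'e) path \<Rightarrow> (bool \<times> 'e) list" where
  "path_deg (Vtx A) = []"
| "path_deg (Edges es) = map (Pair True) es"

definition lcomp :: "('v, 'e) ultragraph \<Rightarrow> (bool \<times> 'e) list
    \<Rightarrow> (('v, 'e) lgen, 'r::comm_ring_1) fpoly set set" where
  "lcomp G t = lspan (leavitt G)
     {lmonom G (path_word \<alpha> @ [P A] @ path_word_star \<beta>) | \<alpha> A \<beta>.
        fin_path G \<alpha> \<and> A \<in> gverts G \<and> fin_path G \<beta> \<and>
        path_deg \<alpha> \<otimes>\<^bsub>free_group (edges G)\<^esub> inv\<^bsub>free_group (edges G)\<^esub> path_deg \<beta> = t}"

end

theory Submission
  imports Defs
begin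

text \<open>If \<open>T\<^sub>1 = T\<^sub>g T\<^bsub>g\<inverse>\<^esub>\<close>, then every \<open>p\<^sub>v \<noteq> 0\<close> must be met by some \<open>s\<^sub>\<alpha> p\<^sub>A s\<^sub>\<beta>\<^sup>*\<close> of degree \<open>g\<close> that
  does not vanish on the left at \<open>v\<close>. For \<open>g = e\<close> the path \<open>\<alpha>\<close> begins with \<open>e\<close>, so \<open>v = s(e)\<close>; for
  \<open>g = e\<inverse>f\<close> with \<open>e \<noteq> f\<close> there is no such element at all. Vanishing is tested in the representation
  on functions on \<open>G\<^sup>0 \<times> \<nat>\<close> given by a branching system. Conversely, for a single loop the same kind of
  representation, now on functions on \<open>\<int>\<close>, identifies the algebra with \<open>R[x, x\<inverse>]\<close>.\<close>

section \<open>Scaling and additive induction for finitely supported functions\<close>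

lemma lookup_scale: "Poly_Mapping.lookup (scale c x) w = c * Poly_Mapping.lookup x w"
  by (simp add: scale_def map.rep_eq when_def)

lemma scale_minus: "scale c (x - y) = scale c x - scale c y"
  by (rule poly_mapping_eqI) (simp add: lookup_scale lookup_minus right_diff_distrib)

lemma single_eq_scale_monom: "Poly_Mapping.single (FWord u) c = scale c (monom u)"
  by (rule poly_mapping_eqI) (simp add: lookup_scale monom_def lookup_single when_def)

lemma poly_mapping_eq_sum_single:
  fixes x :: "'a \<Rightarrow>\<^sub>0 'b::comm_monoid_add"
  shows "x = (\<Sum>w\<in>Poly_Mapping.keys x. Poly_Mapping.single w (Poly_Mapping.lookup x w))"
proof (rule poly_mapping_eqI)
  fix w
  show "Poly_Mapping.lookup x w = Poly_Mapping.lookup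
    (\<Sum>w\<in>Poly_Mapping.keys x. Poly_Mapping.single w (Poly_Mapping.lookup x w)) w"
    by (simp add: lookup_sum lookup_single when_def not_in_keys_iff_lookup_eq_zero)
qed

text \<open>Every \<open>x\<close> is a finite sum of singles, so a property closed under addition
  need only be checked on these. No disjointness of supports is asked for in the \<open>add\<close>
  case, which suits linear statements.\<close>

lemma poly_mapping_add_induct [case_names zero single add]:
  fixes x :: "'a \<Rightarrow>\<^sub>0 'b::comm_monoid_add"
  assumes "Q 0" "\<And>w c. Q (Poly_Mapping.single w c)" "\<And>x y. Q x \<Longrightarrow> Q y \<Longrightarrow> Q (x + y)"
  shows "Q x"
proof -
  have "Q (\<Sum>w\<in>K. Poly_Mapping.single w (Poly_Mapping.lookup x w))" for K
    by (induction K rule: infinite_finite_induct) (simp_all add: assms)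
  then show ?thesis
    by (subst poly_mapping_eq_sum_single)
qed

section \<open>Linear actions of free algebras\<close>

locale linear_action =
  fixes act :: "'x \<Rightarrow> ('b \<Rightarrow> 'r::comm_ring_1) \<Rightarrow> 'b \<Rightarrow> 'r"
  assumes act_add: "act g (\<lambda>a. f a + h a) = (\<lambda>a. act g f a + act g h a)"
    and act_mult: "act g (\<lambda>a. c * f a) = (\<lambda>a. c * act g f a)"
begin

text \<open>The extension of \<open>act\<close> to the free algebra, evaluated at a point
  \<open>a\<close>. Since \<open>foldr\<close> lets the last letter act first, concatenation of
  words becomes composition of operators.\<close>

definition ev :: "('x, 'r) fpoly \<Rightarrow> ('b \<Rightarrow> 'r) \<Rightarrow> 'b \<Rightarrow> 'r" where
  "ev x f a = (\<Sum>w\<in>Poly_Mapping.keys x. Poly_Mapping.lookup x w * foldr act (letters w) f a)"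

lemma foldr_act_add: "foldr act w (\<lambda>a. f a + h a) = (\<lambda>a. foldr act w f a + foldr act w h a)"
  by (induction w) (simp_all add: act_add)

lemma foldr_act_mult: "foldr act w (\<lambda>a. c * f a) = (\<lambda>a. c * foldr act w f a)"
  by (induction w) (simp_all add: act_mult)

text \<open>Sums over the supports of different elements become comparable once they run over a
  common finite set.\<close>

lemma ev_superset:
  assumes "finite K" "Poly_Mapping.keys x \<subseteq> K"
  shows "ev x f a = (\<Sum>w\<in>K. Poly_Mapping.lookup x w * foldr act (letters w) f a)"
  unfolding ev_def
  by (rule sum.mono_neutral_left) (use assms in \<open>auto simp: not_in_keys_iff_lookup_eq_zero\<close>)

lemma ev_zero: "ev 0 f a = 0"
  by (simp add: ev_def)

lemma ev_single: "ev (Poly_Mapping.single w c) f a = c * foldr act (letters w) f a"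
  by (simp add: ev_superset[of "{w}"])

lemma ev_monom: "ev (monom w) f a = foldr act w f a"
  by (simp add: monom_def ev_single)

lemma ev_add: "ev (x + y) f a = ev x f a + ev y f a"
proof -
  let ?K = "Poly_Mapping.keys x \<union> Poly_Mapping.keys y"
  have "Poly_Mapping.keys (x + y) \<subseteq> ?K"
    by (rule Poly_Mapping.keys_add)
  then show ?thesis
    by (simp add: ev_superset[of ?K] lookup_add distrib_right sum.distrib)
qed

lemma ev_scale: "ev (scale c x) f a = c * ev x f a"
proof -
  have "Poly_Mapping.keys (scale c x) \<subseteq> Poly_Mapping.keys x"
    by (auto simp: in_keys_iff lookup_scale)
  then show ?thesis
    by (simp add: ev_superset[of "Poly_Mapping.keys x"] lookup_scale sum_distrib_left mult.assoc)
qed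

lemma ev_minus: "ev (x - y) f a = ev x f a - ev y f a"
  using ev_add[of "x - y" y f a] by simp

lemma ev_sum: "ev (sum h K) f a = (\<Sum>i\<in>K. ev (h i) f a)"
  by (induction K rule: infinite_finite_induct) (simp_all add: ev_zero ev_add)

text \<open>A word acts linearly, so it passes through the sum defining \<open>ev y f\<close>. This
  is multiplicativity of \<open>ev\<close> when the left factor is a single word.\<close>

lemma foldr_act_ev: "foldr act u (ev y f) a = ev (Poly_Mapping.single (FWord u) 1 * y) f a"
proof (induction y arbitrary: a rule: poly_mapping_add_induct)
  case zero
  \<comment> \<open>The zero function is written as a scalar multiple, so that linearity alone shows
    that it is sent to zero.\<close>
  have "foldr act u (\<lambda>a. 0 * 0) = (\<lambda>a. 0 * foldr act u (\<lambda>a. 0) a)"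
    by (rule foldr_act_mult)
  moreover have "ev 0 f = (\<lambda>a. 0)"
    by (simp add: fun_eq_iff ev_zero)
  ultimately show ?case
    by (simp add: ev_zero)
next
  case (single w c)
  have "ev (Poly_Mapping.single w c) f = (\<lambda>a. c * foldr act (letters w) f a)"
    by (simp add: fun_eq_iff ev_single)
  then show ?case
    by (simp add: foldr_act_mult mult_single ev_single plus_fword_def)
next
  case (add x y)
  have "ev (x + y) f = (\<lambda>a. ev x f a + ev y f a)"
    by (simp add: fun_eq_iff ev_add)
  then show ?case
    by (simp add: foldr_act_add add distrib_left ev_add)
qed

lemma ev_mult: "ev (x * y) f a = ev x (ev y f) a"
proof (induction x rule: poly_mapping_add_induct)
  case (single w c)
  \<comment> \<open>The scalar is pulled out of the word, which leaves the case treated in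
    \<open>foldr_act_ev\<close>.\<close>
  have "Poly_Mapping.single w c * y = scale c (Poly_Mapping.single w 1 * y)"
  proof -
    have "Poly_Mapping.single w c = scale c (Poly_Mapping.single w 1)"
      by (rule poly_mapping_eqI) (simp add: lookup_scale lookup_single when_def)
    moreover have "scale c z = Poly_Mapping.single 0 c * z" for z :: "('x, 'r) fpoly"
      unfolding scale_def by (rule mult_map_scale_conv_mult)
    ultimately show ?thesis
      by (simp add: mult.assoc)
  qed
  then show ?case
    by (cases w) (simp add: ev_single ev_scale foldr_act_ev)
qed (simp_all add: ev_zero ev_add distrib_right)

text \<open>The elements acting as zero form a two-sided ideal, so an action that respects the
  relations in \<open>T\<close> descends to the quotient.\<close>

lemma ev_alg_ideal:
  assumes "x \<in> alg_ideal (free_algebra X) T" and "\<And>x f a. x \<in> T \<Longrightarrow> ev x f a = 0"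
  shows "ev x f a = 0"
  using assms(1)
proof (induction arbitrary: f a)
  case (mult_l b x)
  have "ev x f = (\<lambda>a. 0 * 0)" for f
    using mult_l.IH by (simp add: fun_eq_iff)
  then have "ev (b * x) f a = ev b (\<lambda>a. 0 * 0) a"
    by (simp only: ev_mult)
  also have "\<dots> = 0"
    by (simp only: ev_def foldr_act_mult) simp
  finally show ?case
    by simp
qed (simp_all add: assms(2) ev_zero ev_add ev_scale ev_mult)

end

section \<open>Algebras given by generators and relations\<close>

locale presented_algebra =
  fixes X :: "'x set" and T :: "('x, 'r::comm_ring_1) fpoly set"
  assumes T_subset: "T \<subseteq> carrier (free_algebra X)"
begin

abbreviation "A \<equiv> free_algebra X :: ('r, ('x, 'r) fpoly) module"
abbreviation "I \<equiv> alg_ideal A T"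
abbreviation "L \<equiv> quot_algebra A I"
abbreviation "cls x \<equiv> I +>\<^bsub>A\<^esub> x"

lemma A_zero: "0 \<in> carrier A"
  by (simp add: mem_free_algebra)

lemma ideal_uminus: "x \<in> I \<Longrightarrow> - x \<in> I"
proof -
  assume "x \<in> I"
  moreover have "scale (- 1) x = - x"
    by (rule poly_mapping_eqI) (simp add: lookup_scale)
  ultimately show ?thesis
    using alg_ideal.smult[of x A T "- 1"] by simp
qed

lemma ideal_add: "x \<in> I \<Longrightarrow> y \<in> I \<Longrightarrow> x + y \<in> I"
  using alg_ideal.add[of x A T y] by simp

lemma ideal_minus: "x \<in> I \<Longrightarrow> y \<in> I \<Longrightarrow> x - y \<in> I"
  using ideal_add[of x "- y"] ideal_uminus by simp

lemma ideal_scale: "x \<in> I \<Longrightarrow> scale c x \<in> I"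
  using alg_ideal.smult[of x A T c] by simp

lemma ideal_sum: "(\<And>i. i \<in> K \<Longrightarrow> h i \<in> I) \<Longrightarrow> sum h K \<in> I"
  using alg_ideal.zero[of A T]
  by (induction K rule: infinite_finite_induct) (simp_all add: ideal_add)

text \<open>Cosets are handled through differences from here on, so that equality of classes becomes
  membership in \<open>I\<close>.\<close>

lemma mem_cls_iff: "y \<in> cls x \<longleftrightarrow> y - x \<in> I"
proof -
  have "y \<in> cls x \<longleftrightarrow> (\<exists>i\<in>I. y = i + x)"
    by (simp add: a_r_coset_def r_coset_def)
  also have "\<dots> \<longleftrightarrow> y - x \<in> I"
    by (metis add_diff_cancel_right' diff_add_cancel)
  finally show ?thesis .
qed

lemma cls_eq_iff: "cls x = cls y \<longleftrightarrow> x - y \<in> I"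
proof
  assume "cls x = cls y"
  moreover have "x \<in> cls x"
    using alg_ideal.zero[of A T] by (simp add: mem_cls_iff)
  ultimately show "x - y \<in> I"
    by (simp add: mem_cls_iff)
next
  assume *: "x - y \<in> I"
  then have "z - x \<in> I \<longleftrightarrow> z - y \<in> I" for z
    using ideal_add[of "z - x" "x - y"] ideal_minus[of "z - y" "x - y"] by fastforce
  then show "cls x = cls y"
    using mem_cls_iff by blast
qed

lemma cls_zero: "cls 0 = I"
  using mem_cls_iff[of _ 0] by auto

lemma L_zero: "\<zero>\<^bsub>L\<^esub> = cls 0"
  by (simp add: quot_algebra_def cls_zero)

lemma carrier_L: "carrier L = cls ` carrier A"
  by (auto simp: quot_algebra_def A_RCOSETS_def')

lemma cls_in_L: "x \<in> carrier A \<Longrightarrow> cls x \<in> carrier L"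
  by (simp add: carrier_L)

lemma cls_add: "cls x \<oplus>\<^bsub>L\<^esub> cls y = cls (x + y)"
proof -
  have "\<exists>u v. u - x \<in> I \<and> v - y \<in> I \<and> z = u + v" if "z - (x + y) \<in> I" for z
  \<comment> \<open>The witnesses are \<open>u = z - y\<close> and \<open>v = y\<close>.\<close>
  proof (intro exI conjI)
    show "z - y - x \<in> I"
      using that by (simp add: diff_diff_eq add.commute)
    show "y - y \<in> I"
      using alg_ideal.zero[of A T] by simp
  qed simp
  moreover have "u + v - (x + y) \<in> I" if "u - x \<in> I" "v - y \<in> I" for u v
    using ideal_add[OF that] by (simp add: algebra_simps)
  ultimately have "z \<in> cls (x + y) \<longleftrightarrow> (\<exists>u v. u \<in> cls x \<and> v \<in> cls y \<and> z = u + v)" for z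
    unfolding mem_cls_iff by blast
  moreover have "z \<in> cls x <+>\<^bsub>A\<^esub> cls y \<longleftrightarrow> (\<exists>u v. u \<in> cls x \<and> v \<in> cls y \<and> z = u + v)" for z
    unfolding set_add_def' by auto
  ultimately have "cls x <+>\<^bsub>A\<^esub> cls y = cls (x + y)"
    by blast
  then show ?thesis
    by (simp add: quot_algebra_def)
qed

lemma cls_mult: "x \<in> carrier A \<Longrightarrow> y \<in> carrier A \<Longrightarrow> cls x \<otimes>\<^bsub>L\<^esub> cls y = cls (x * y)"
  by (rule quot_algebra_mult[OF T_subset])

text \<open>Scaling in the quotient is a union over all representatives. All of them give the same
  coset, because \<open>I\<close> is closed under scaling.\<close>

lemma cls_scale: "c \<odot>\<^bsub>L\<^esub> cls x = cls (scale c x)"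
proof -
  have "cls (scale c y) = cls (scale c x)" if "y \<in> cls x" for y
    using that ideal_scale[of "y - x" c] by (simp add: mem_cls_iff cls_eq_iff scale_minus)
  moreover have "x \<in> cls x"
    using alg_ideal.zero[of A T] by (simp add: mem_cls_iff)
  ultimately have "(\<Union>y\<in>cls x. cls (scale c y)) = cls (scale c x)"
    by blast
  then show ?thesis
    by (simp add: quot_algebra_def)
qed

lemma abelian_group_L: "abelian_group L"
proof (rule abelian_groupI)
  fix Y assume "Y \<in> carrier L"
  then obtain y where y: "y \<in> carrier A" "Y = cls y"
    by (auto simp: carrier_L)
  then have "cls (- y) \<oplus>\<^bsub>L\<^esub> Y = \<zero>\<^bsub>L\<^esub>"
    by (simp add: cls_add L_zero)
  moreover have "cls (- y) \<in> carrier L"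
    using y by (auto simp: carrier_L free_algebra_closed)
  ultimately show "\<exists>Z\<in>carrier L. Z \<oplus>\<^bsub>L\<^esub> Y = \<zero>\<^bsub>L\<^esub>"
    by blast
next
  fix Y Z assume "Y \<in> carrier L" "Z \<in> carrier L"
  then show "Y \<oplus>\<^bsub>L\<^esub> Z \<in> carrier L" "Y \<oplus>\<^bsub>L\<^esub> Z = Z \<oplus>\<^bsub>L\<^esub> Y"
    unfolding carrier_L by (auto simp: cls_add free_algebra_closed(3) add.commute)
next
  fix Y Z W assume "Y \<in> carrier L" "Z \<in> carrier L" "W \<in> carrier L"
  then show "Y \<oplus>\<^bsub>L\<^esub> Z \<oplus>\<^bsub>L\<^esub> W = Y \<oplus>\<^bsub>L\<^esub> (Z \<oplus>\<^bsub>L\<^esub> W)"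
    unfolding carrier_L by (auto simp: cls_add add.assoc)
next
  show "\<zero>\<^bsub>L\<^esub> \<in> carrier L"
    unfolding carrier_L L_zero using A_zero by (rule imageI)
next
  fix Y assume "Y \<in> carrier L"
  then show "\<zero>\<^bsub>L\<^esub> \<oplus>\<^bsub>L\<^esub> Y = Y"
    unfolding carrier_L L_zero by (auto simp: cls_add)
qed

end

section \<open>Branching systems\<close>

text \<open>A branching system consists of sets \<open>D\<^sub>v\<close> and \<open>R\<^sub>e \<subseteq> D\<^bsub>s(e)\<^esub>\<close> with bijections \<open>\<Union>\<^bsub>v \<in> r(e)\<^esub> D\<^sub>v \<rightarrow> R\<^sub>e\<close>.
  Here \<open>ver a = v\<close> means \<open>a \<in> D\<^sub>v\<close>, the bijection of \<open>e\<close> is \<open>ext e\<close>, and \<open>nxt a = Some (e, b)\<close>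
  means \<open>a = ext e b \<in> R\<^sub>e\<close>. The parameter \<open>scalars\<close> only fixes the type of the coefficients.\<close>

locale branching_system =
  fixes G :: "('v, 'e) ultragraph" and ver :: "'b \<Rightarrow> 'v" and nxt :: "'b \<Rightarrow> ('e \<times> 'b) option"
    and ext :: "'e \<Rightarrow> 'b \<Rightarrow> 'b" and scalars :: "'r::comm_ring_1 itself"
  assumes ultragraph: "ultragraph G"
    and nxt_SomeD: "nxt a = Some (e, b) \<Longrightarrow>
      e \<in> edges G \<and> ver a = src G e \<and> ver b \<in> rng G e \<and> ext e b = a"
    and nxt_ext: "e \<in> edges G \<Longrightarrow> ver b \<in> rng G e \<Longrightarrow> nxt (ext e b) = Some (e, b)"
    and nxt_not_None: "e \<in> edges G \<Longrightarrow> ver a = src G e \<Longrightarrow> nxt a \<noteq> None"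
begin

text \<open>\<open>S e\<close> transports a function along the bijection \<open>ext e\<close> and
  extends it by zero outside the image, \<open>Sst e\<close> pulls it back along
  \<open>ext e\<close>, and \<open>P A\<close> multiplies by the indicator of the points lying over
  \<open>A\<close>.\<close>

primrec gen_act :: "('v, 'e) lgen \<Rightarrow> ('b \<Rightarrow> 'r) \<Rightarrow> 'b \<Rightarrow> 'r" where
  "gen_act (S e) f = (\<lambda>a. case nxt a of None \<Rightarrow> 0 | Some (e', b) \<Rightarrow> if e' = e then f b else 0)"
| "gen_act (Sst e) f = (\<lambda>a. if ver a \<in> rng G e then f (ext e a) else 0)"
| "gen_act (P A) f = (\<lambda>a. if ver a \<in> A then f a else 0)"

sublocale linear_action gen_act
proof
  fix g :: "('v, 'e) lgen" and f h :: "'b \<Rightarrow> 'r" and c :: 'r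
  show "gen_act g (\<lambda>a. f a + h a) = (\<lambda>a. gen_act g f a + gen_act g h a)"
    by (cases g) (auto simp: fun_eq_iff split: option.split)
  show "gen_act g (\<lambda>a. c * f a) = (\<lambda>a. c * gen_act g f a)"
    by (cases g) (auto simp: fun_eq_iff split: option.split)
qed

sublocale presented_algebra "lgens G" "lrels G :: (('v, 'e) lgen, 'r) fpoly set"
  by unfold_locales (rule lrels_subset[OF ultragraph])

lemma leavitt_eq: "leavitt G = L"
  by (simp add: leavitt_def lideal_def)

lemma lmonom_eq: "lmonom G w = cls (monom w)"
  by (simp add: lmonom_def lideal_def)

lemma ver_ext: "e \<in> edges G \<Longrightarrow> ver b \<in> rng G e \<Longrightarrow> ver (ext e b) = src G e"
  using nxt_SomeD nxt_ext by blast

lemma ev_lrels: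
  assumes "x \<in> lrels G"
  shows "ev x f a = 0"
proof -
  have CK: "ev (\<Sum>e | e \<in> edges G \<and> src G e = src G d. monom [S e, Sst e]) f a =
      (if ver a = src G d then f a else 0)"
    if d: "d \<in> edges G" "finite {e \<in> edges G. src G e = src G d}" for d
  proof (cases "ver a = src G d")
    case True
    \<comment> \<open>The images of the edges leaving a vertex partition the points over it. So
      exactly one edge has \<open>a\<close> in its image, and only its summand survives.\<close>
    with d(1) nxt_not_None obtain e b where eb: "nxt a = Some (e, b)"
      by fast
    have "gen_act (S e') (gen_act (Sst e') f) a = (if e' = e then f a else 0)" for e'
      using eb nxt_SomeD[OF eb] by auto
    with d(2) True nxt_SomeD[OF eb] show ?thesis
      by (simp add: ev_sum ev_monom del: gen_act.simps(1,2))
  next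
    case False
    then have "gen_act (S e) (gen_act (Sst e) f) a = 0" if "src G e = src G d" for e
      using nxt_SomeD that by (auto split: option.split)
    with False show ?thesis
      by (simp add: ev_sum ev_monom del: gen_act.simps(1,2))
  qed
  have "gen_act (P {src G e}) (gen_act (S e) f) = gen_act (S e) f"
    "gen_act (S e) (gen_act (P (rng G e)) f) = gen_act (S e) f"
    "gen_act (P (rng G e)) (gen_act (Sst e) f) = gen_act (Sst e) f" for e
    using nxt_SomeD by (auto simp: fun_eq_iff split: option.split)
  moreover have "gen_act (Sst e) (gen_act (P {src G e}) f) = gen_act (Sst e) f"
    "gen_act (Sst e) (gen_act (S e') f) = (if e = e' then gen_act (P (rng G e)) f else (\<lambda>a. 0))"
    if "e \<in> edges G" for e e'
    using that by (auto simp: fun_eq_iff ver_ext nxt_ext)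
  ultimately show ?thesis
    using assms CK unfolding lrels_def
    by (auto simp: ev_minus ev_add ev_zero ev_monom monom_mult simp del: gen_act.simps(1,2))
qed

lemma ev_ideal: "x \<in> I \<Longrightarrow> ev x f a = 0"
  using ev_alg_ideal ev_lrels by blast

lemma ev_cls: "y \<in> cls x \<Longrightarrow> ev y f a = ev x f a"
  using ev_ideal[of "y - x" f a] by (simp add: mem_cls_iff ev_minus)

text \<open>The test is local: it only looks at the values at \<open>a\<close> of the functions in
  the image of the operator. By \<open>ev_cls\<close> it does not depend on the
  representative.\<close>

definition vanishes_at :: "(('v, 'e) lgen, 'r) fpoly set \<Rightarrow> 'b \<Rightarrow> bool" where
  "vanishes_at Y a \<longleftrightarrow> (\<forall>x\<in>Y. \<forall>f. ev x f a = 0)"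

lemma vanishes_at_cls: "vanishes_at (cls x) a \<longleftrightarrow> (\<forall>f. ev x f a = 0)"
proof -
  have "x \<in> cls x"
    using alg_ideal.zero[of A "lrels G"] by (simp add: mem_cls_iff)
  then show ?thesis
    unfolding vanishes_at_def using ev_cls by metis
qed

lemma vanishes_at_lspan:
  assumes "Y \<in> lspan L M" "M \<subseteq> carrier L" "\<And>m. m \<in> M \<Longrightarrow> vanishes_at m a"
  shows "Y \<in> carrier L \<and> vanishes_at Y a"
  using assms(1)
proof induction
  case zero
  show ?case
    unfolding L_zero vanishes_at_cls by (simp add: cls_in_L[OF A_zero] ev_zero)
next
  case (add m Y c)
  then obtain x y where "m = cls x" "x \<in> carrier A" "Y = cls y" "y \<in> carrier A"
    using assms(2) by (auto simp: carrier_L)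
  with add assms(3)[OF add(1)] show ?case
    by (simp add: cls_in_L cls_scale cls_add vanishes_at_cls ev_add ev_scale free_algebra_closed)
qed

text \<open>The left factor acts last, so a product vanishes at \<open>a\<close> as soon as its left
  factor does, whatever the right factor is.\<close>

lemma vanishes_at_sum_prods:
  assumes "Y \<in> sum_prods L U V" "U \<subseteq> carrier L" "V \<subseteq> carrier L" "\<And>u. u \<in> U \<Longrightarrow> vanishes_at u a"
  shows "Y \<in> carrier L \<and> vanishes_at Y a"
  using assms(1)
proof induction
  case zero
  show ?case
    unfolding L_zero vanishes_at_cls by (simp add: cls_in_L[OF A_zero] ev_zero)
next
  case (add u v Y)
  then obtain x y z where "u = cls x" "x \<in> carrier A" "v = cls y" "y \<in> carrier A"
      "Y = cls z" "z \<in> carrier A"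
    using assms(2,3) by (fastforce simp: carrier_L)
  with add assms(4)[OF add(1)] show ?case
    by (simp add: cls_in_L cls_mult cls_add vanishes_at_cls ev_add ev_mult free_algebra_closed)
qed

lemma word_in_lgens:
  assumes "fin_path G \<alpha>" "B \<in> gverts G" "fin_path G \<beta>"
  shows "set (path_word \<alpha> @ [P B] @ path_word_star \<beta>) \<subseteq> lgens G"
  using assms by (cases \<alpha>; cases \<beta>) (auto simp: lgens_def)

lemma lmonom_path_in_carrier:
  assumes "fin_path G \<alpha>" "B \<in> gverts G" "fin_path G \<beta>"
  shows "lmonom G (path_word \<alpha> @ [P B] @ path_word_star \<beta>) \<in> carrier L"
  using word_in_lgens[OF assms] by (auto simp: lmonom_eq carrier_L intro!: imageI monom_closed)

lemma lcomp_in_carrier: "lcomp G t \<subseteq> carrier L"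
proof
  fix Y :: "(('v, 'e) lgen, 'r) fpoly set" assume "Y \<in> lcomp G t"
  then show "Y \<in> carrier L"
    unfolding lcomp_def leavitt_eq
  proof induction
    case zero
    show ?case
      unfolding L_zero by (rule cls_in_L[OF A_zero])
  next
    case (add m Y c)
    then have "m \<in> carrier L"
      using lmonom_path_in_carrier by blast
    with add.IH obtain x y where "m = cls x" "x \<in> carrier A" "Y = cls y" "y \<in> carrier A"
      unfolding carrier_L by blast
    then show ?case
      by (simp add: cls_scale cls_add cls_in_L free_algebra_closed)
  qed
qed

text \<open>The projection at \<open>ver a\<close> does not vanish at \<open>a\<close> and lies in
  the neutral component, which is the product of the components of \<open>g\<close> and its inverse.
  Hence some element of degree \<open>g\<close>, and then some spanning element of that degree, does
  not vanish at \<open>a\<close>.\<close>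

lemma strongly_graded_nonvanishing_path:
  assumes strong: "strongly_graded (free_group (edges G)) (leavitt G :: ('v, 'e, 'r) lpa) (lcomp G)"
    and a: "ver a \<in> verts G" and g: "g \<in> carrier (free_group (edges G))"
  obtains \<alpha> B \<beta> f where "fin_path G \<alpha>" "fin_path G \<beta>"
    "path_deg \<alpha> \<otimes>\<^bsub>free_group (edges G)\<^esub> inv\<^bsub>free_group (edges G)\<^esub> path_deg \<beta> = g"
    "foldr gen_act (path_word \<alpha> @ [P B] @ path_word_star \<beta>) f a \<noteq> 0"
proof -
  \<comment> \<open>The projection is written as its own cube, which is literally the spanning
    element with both paths equal to the vertex.\<close>
  let ?F = "free_group (edges G)" and ?w = "[P {ver a}, P {ver a}, P {ver a}]"
  interpret F: group ?F
    by (rule group_free_group)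
  have one: "[] = \<one>\<^bsub>?F\<^esub>"
    by (simp add: free_group_def)
  have deg: "[] \<otimes>\<^bsub>?F\<^esub> inv\<^bsub>?F\<^esub> [] = []"
    unfolding one by simp
  have v: "{ver a} \<in> gverts G"
    using a by (rule gverts.singleton)
  let ?p = "lmonom G ?w :: (('v, 'e) lgen, 'r) fpoly set"
  have "\<not> vanishes_at (?p) a"
    unfolding lmonom_eq vanishes_at_cls ev_monom by (auto intro!: exI[of _ "\<lambda>_. 1"])
  moreover have "?p \<in> lcomp G []"
  proof -
    let ?M = "{lmonom G (path_word \<alpha> @ [P A] @ path_word_star \<beta>) | \<alpha> A \<beta>.
        fin_path G \<alpha> \<and> A \<in> gverts G \<and> fin_path G \<beta> \<and>
        path_deg \<alpha> \<otimes>\<^bsub>?F\<^esub> inv\<^bsub>?F\<^esub> path_deg \<beta> = []} :: (('v, 'e) lgen, 'r) fpoly set set"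
    have "?p \<in> ?M"
      by (rule CollectI, rule exI[of _ "Vtx {ver a}"], rule exI[of _ "{ver a}"],
          rule exI[of _ "Vtx {ver a}"]) (use v deg in simp)
    then have "1 \<odot>\<^bsub>L\<^esub> ?p \<oplus>\<^bsub>L\<^esub> \<zero>\<^bsub>L\<^esub> \<in> lspan L ?M"
      by (intro lspan.intros)
    moreover have "1 \<odot>\<^bsub>L\<^esub> ?p \<oplus>\<^bsub>L\<^esub> \<zero>\<^bsub>L\<^esub> = ?p"
    proof -
      have "scale 1 x = x" for x :: "(('v, 'e) lgen, 'r) fpoly"
        by (rule poly_mapping_eqI) (simp add: lookup_scale)
      then show ?thesis
        by (simp add: lmonom_eq cls_scale cls_add L_zero)
    qed
    ultimately show ?thesis
      by (simp add: lcomp_def leavitt_eq)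
  qed
  moreover have "(lcomp G [] :: (('v, 'e) lgen, 'r) fpoly set set) = sum_prods L (lcomp G g) (lcomp G (inv\<^bsub>?F\<^esub> g))"
    \<comment> \<open>Strong grading is applied to \<open>g\<close> and its inverse.\<close>
    using strong g F.r_inv[OF g] unfolding strongly_graded_def leavitt_eq one
    by (metis F.inv_closed)
  ultimately have p: "\<not> vanishes_at ?p a" "?p \<in> sum_prods L (lcomp G g) (lcomp G (inv\<^bsub>?F\<^esub> g))"
    by simp_all
  obtain u :: "(('v, 'e) lgen, 'r) fpoly set" where u: "u \<in> lcomp G g" "\<not> vanishes_at u a"
    using vanishes_at_sum_prods[OF p(2) lcomp_in_carrier lcomp_in_carrier, of a] p(1) by blast
  let ?N = "{lmonom G (path_word \<alpha> @ [P A] @ path_word_star \<beta>) | \<alpha> A \<beta>.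
      fin_path G \<alpha> \<and> A \<in> gverts G \<and> fin_path G \<beta> \<and>
      path_deg \<alpha> \<otimes>\<^bsub>?F\<^esub> inv\<^bsub>?F\<^esub> path_deg \<beta> = g} :: (('v, 'e) lgen, 'r) fpoly set set"
  have "u \<in> lspan L ?N"
    using u(1) by (simp add: lcomp_def leavitt_eq)
  moreover have "?N \<subseteq> carrier L"
    using lmonom_path_in_carrier by blast
  ultimately obtain m where "m \<in> ?N" "\<not> vanishes_at m a"
    using vanishes_at_lspan[of u ?N a] u(2) by blast
  then obtain \<alpha> B \<beta> where \<alpha>: "fin_path G \<alpha>" "fin_path G \<beta>"
      "path_deg \<alpha> \<otimes>\<^bsub>?F\<^esub> inv\<^bsub>?F\<^esub> path_deg \<beta> = g"
      "\<not> vanishes_at (lmonom G (path_word \<alpha> @ [P B] @ path_word_star \<beta>)) a"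
    by blast
  moreover obtain f where "foldr gen_act (path_word \<alpha> @ [P B] @ path_word_star \<beta>) f a \<noteq> 0"
    using \<alpha>(4) unfolding lmonom_eq vanishes_at_cls ev_monom by blast
  ultimately show ?thesis
    using that by blast
qed

end

section \<open>Degrees of paths in the free group\<close>

lemma path_deg_in_carrier:
  assumes "fin_path G \<alpha>"
  shows "path_deg \<alpha> \<in> carrier (free_group (edges G))"
proof -
  have "reduced (map (Pair True) es)" for es :: "'b list"
  proof (induction es)
    case (Cons e es)
    then show ?case by (cases es) auto
  qed simp
  with assms show ?thesis
    by (cases \<alpha>) (auto simp: free_group_def)
qed

text \<open>Solving for the degree of \<alpha> removes the inverse. What remains is to push the
  letters of \<open>g\<close> onto a word without inverse letters, which can be computed.\<close>

lemma path_deg_eqD: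
  assumes "fin_path G \<alpha>" "fin_path G \<beta>" "g \<in> carrier (free_group (edges G))"
    "path_deg \<alpha> \<otimes>\<^bsub>free_group (edges G)\<^esub> inv\<^bsub>free_group (edges G)\<^esub> path_deg \<beta> = g"
  shows "path_deg \<alpha> = foldr push g (path_deg \<beta>)"
proof -
  interpret F: group "free_group (edges G)"
    by (rule group_free_group)
  have "path_deg \<alpha> = g \<otimes>\<^bsub>free_group (edges G)\<^esub> path_deg \<beta>"
    using assms path_deg_in_carrier by (metis F.inv_solve_right)
  then show ?thesis
    by (simp add: free_group_def)
qed

lemma path_deg_positive: "x \<in> set (path_deg \<alpha>) \<Longrightarrow> fst x"
  by (cases \<alpha>) auto

text \<open>Countability of edges makes \<open>{v} \<times> \<nat>\<close> and \<open>\<Union> {e} \<times> r(e) \<times> \<nat>\<close> (over the edges \<open>e\<close> leaving \<open>v\<close>)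
  equinumerous whenever \<open>v\<close> is not a sink.\<close>

lemma branching_system_exists:
  fixes G :: "('v, 'e) ultragraph"
  assumes G: "ultragraph G"
  obtains nxt ext where
    "branching_system G (fst :: 'v \<times> nat \<Rightarrow> 'v) nxt ext"
proof -
  define C :: "'v \<Rightarrow> ('e \<times> 'v \<times> nat) set"
    where "C v = Sigma {e \<in> edges G. src G e = v} (\<lambda>e. rng G e \<times> UNIV)" for v
  \<comment> \<open>Over a vertex emitting edges, the point \<open>(v, n)\<close> is decoded as the
    \<open>n\<close>-th element of \<open>C v\<close>; over a sink there is nothing to decode.
    \<open>ext\<close> below is the inverse encoding.\<close>
  define nxt where "nxt a =
    (if \<exists>e\<in>edges G. src G e = fst a then Some (from_nat_into (C (fst a)) (snd a)) else None)"
    for a :: "'v \<times> nat"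
  define ext where "ext e b = (src G e, to_nat_on (C (src G e)) (e, b))" for e b
  have sub: "rng G e \<subseteq> verts G" "rng G e \<noteq> {}" if "e \<in> edges G" for e
    using G that by (auto simp: ultragraph_def)
  have countable: "countable (C v)" for v
  proof -
    have "C v \<subseteq> edges G \<times> verts G \<times> UNIV"
      using sub by (auto simp: C_def)
    then show ?thesis
      using G by (auto simp: ultragraph_def intro: countable_subset)
  qed
  \<comment> \<open>Infinity of \<open>C v\<close> makes its enumeration a bijection with all of
    \<nat>, so that every point over a non-sink is decoded exactly once. The factor \<nat> provides
    it even for finite ranges.\<close>
  have infinite: "infinite (C (src G e))" if e: "e \<in> edges G" for e
  proof -
    obtain v where "v \<in> rng G e"
      using sub e by blast
    then have "range (\<lambda>n. (e, v, n)) \<subseteq> C (src G e)"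
      using e by (auto simp: C_def)
    moreover have "infinite (range (\<lambda>n::nat. (e, v, n)))"
      by (rule range_inj_infinite) (auto simp: inj_def)
    ultimately show ?thesis
      using finite_subset by blast
  qed
  have "branching_system G fst nxt ext"
  proof
    show "ultragraph G"
      by (rule G)
  next
    fix a b e assume a: "nxt a = Some (e, b)"
    then obtain e' where e': "e' \<in> edges G" "src G e' = fst a"
      and eb: "from_nat_into (C (fst a)) (snd a) = (e, b)"
      by (auto simp: nxt_def split: if_splits)
    have inf: "infinite (C (fst a))"
      using infinite[OF e'(1)] e'(2) by simp
    have "(e, b) \<in> C (fst a)"
      using from_nat_into[OF infinite_imp_nonempty[OF inf], of "snd a"] eb by simp
    moreover have "to_nat_on (C (fst a)) (e, b) = snd a"
      using to_nat_on_from_nat_into_infinite[OF countable inf, of "snd a"] eb by simp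
    ultimately show "e \<in> edges G \<and> fst a = src G e \<and> fst b \<in> rng G e \<and> ext e b = a"
      by (auto simp: C_def ext_def)
  next
    fix e and b :: "'v \<times> nat" assume "e \<in> edges G" "fst b \<in> rng G e"
    moreover from this have "(e, b) \<in> C (src G e)"
      by (cases b) (auto simp: C_def)
    ultimately show "nxt (ext e b) = Some (e, b)"
      using countable by (auto simp: nxt_def ext_def)
  next
    fix e and a :: "'v \<times> nat" assume "e \<in> edges G" "fst a = src G e"
    then show "nxt a \<noteq> None"
      unfolding nxt_def by (metis option.distinct(1))
  qed
  then show ?thesis
    by (rule that)
qed

text \<open>The conclusion on the vertices is what the test at points yields. It forces the nonempty
  set \<open>rng G e\<close> to be \<open>{src G e}\<close> and also rules out isolated
  vertices.\<close>

lemma strongly_graded_imp_one_edge: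
  fixes G :: "('v, 'e) ultragraph"
  assumes G: "ultragraph G" "edges G \<noteq> {}"
    and strong: "strongly_graded (free_group (edges G)) (leavitt G :: ('v, 'e, 'r::comm_ring_1) lpa) (lcomp G)"
  shows "\<exists>e. edges G = {e} \<and> verts G = {src G e}"
proof -
  obtain nxt ext where "branching_system G (fst :: 'v \<times> nat \<Rightarrow> 'v) nxt ext"
    using branching_system_exists[OF G(1)] .
  then interpret branching_system G "fst :: 'v \<times> nat \<Rightarrow> 'v" nxt ext "TYPE('r)" .
  have src: "src G e \<in> verts G" if "e \<in> edges G" for e
    using G(1) that by (simp add: ultragraph_def)
  have eq_src: "v = src G e" if e: "e \<in> edges G" and v: "v \<in> verts G" for e v
  proof -
    have g: "[(True, e)] \<in> carrier (free_group (edges G))"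
      using e by (simp add: free_group_def)
    have "fst (v, 0::nat) \<in> verts G"
      using v by simp
    then obtain \<alpha> B \<beta> f where \<alpha>: "fin_path G \<alpha>" "fin_path G \<beta>"
        "path_deg \<alpha> \<otimes>\<^bsub>free_group (edges G)\<^esub> inv\<^bsub>free_group (edges G)\<^esub> path_deg \<beta> = [(True, e)]"
        "foldr gen_act (path_word \<alpha> @ [P B] @ path_word_star \<beta>) f (v, 0) \<noteq> 0"
      using strongly_graded_nonvanishing_path[OF strong _ g] by metis
    have "path_deg \<alpha> = push (True, e) (path_deg \<beta>)"
      using path_deg_eqD[OF \<alpha>(1,2) g \<alpha>(3)] by simp
    \<comment> \<open>The degree of \<beta> has no inverse letters, so nothing cancels and \<alpha>
      begins with \<open>e\<close>. Its word then begins with \<open>S e\<close>, which kills every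
      point outside the image of \<open>e\<close>.\<close>
    moreover have "\<dots> = (True, e) # path_deg \<beta>"
      using path_deg_positive[of _ \<beta>] by (cases "path_deg \<beta>") auto
    ultimately obtain es where "\<alpha> = Edges (e # es)"
      by (cases \<alpha>) auto
    then obtain b where "nxt (v, 0) = Some (e, b)"
      using \<alpha>(4) by (auto split: option.splits if_splits)
    then show ?thesis
      using nxt_SomeD by fastforce
  qed
  have "e = e'" if e: "e \<in> edges G" "e' \<in> edges G" for e e'
  proof (rule ccontr)
    assume ne: "e \<noteq> e'"
    have g: "[(False, e), (True, e')] \<in> carrier (free_group (edges G))"
      using e ne by (simp add: free_group_def)
    have "fst (src G e, 0::nat) \<in> verts G"
      using src e by simp
    then obtain \<alpha> B \<beta> f where \<alpha>: "fin_path G \<alpha>" "fin_path G \<beta>"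
        "path_deg \<alpha> \<otimes>\<^bsub>free_group (edges G)\<^esub> inv\<^bsub>free_group (edges G)\<^esub> path_deg \<beta> =
          [(False, e), (True, e')]"
      using strongly_graded_nonvanishing_path[OF strong _ g] by metis
    have "path_deg \<alpha> = push (False, e) (push (True, e') (path_deg \<beta>))"
      using path_deg_eqD[OF \<alpha>(1,2) g \<alpha>(3)] by simp
    \<comment> \<open>Again nothing cancels, and as \<open>e\<close> and \<open>e'\<close> differ
      the inverse letter of \<open>e\<close> stays in front. The degree of a path has no such
      letter.\<close>
    moreover have "push (True, e') (path_deg \<beta>) = (True, e') # path_deg \<beta>"
      using path_deg_positive[of _ \<beta>] by (cases "path_deg \<beta>") auto
    ultimately show False
      using path_deg_positive[of "(False, e)" \<alpha>] ne by simp
  qed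
  with G(2) obtain e where e: "edges G = {e}"
    by blast
  with eq_src src show ?thesis
    by blast
qed

section \<open>A single loop\<close>

fun sign_of :: "bool \<times> 'e \<Rightarrow> int" where
  "sign_of (b, x) = (if b then 1 else - 1)"

text \<open>This is the homomorphism to \<int> sending every generator to 1. On one generator it is
  an isomorphism, with inverse \<open>letter_power\<close>.\<close>

definition exponent :: "(bool \<times> 'e) list \<Rightarrow> int" where
  "exponent w = sum_list (map sign_of w)"

lemma exponent_simps [simp]:
  "exponent [] = 0" "exponent (a # w) = sign_of a + exponent w"
  "exponent (w @ w') = exponent w + exponent w'"
  by (simp_all add: exponent_def)

lemma exponent_replicate [simp]: "exponent (replicate n a) = int n * sign_of a"
  by (induction n) (simp_all add: algebra_simps)

lemma exponent_push: "exponent (push a w) = sign_of a + exponent w"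
  by (cases w; cases a) auto

lemma exponent_mult: "exponent (u \<otimes>\<^bsub>free_group X\<^esub> w) = exponent u + exponent w"
proof -
  have "exponent (foldr push u w) = exponent u + exponent w"
    by (induction u) (simp_all add: exponent_push)
  then show ?thesis
    by (simp add: free_group_def)
qed

lemma exponent_inv:
  assumes "u \<in> carrier (free_group X)"
  shows "exponent (inv\<^bsub>free_group X\<^esub> u) = - exponent u"
proof -
  interpret group "free_group X"
    by (rule group_free_group)
  have "exponent (u \<otimes>\<^bsub>free_group X\<^esub> inv\<^bsub>free_group X\<^esub> u) = 0"
    by (simp only: r_inv[OF assms]) (simp add: free_group_def)
  then show ?thesis
    by (simp add: exponent_mult)
qed

text \<open>As \<open>nat\<close> truncates negative numbers to 0, at least one of the two blocks is
  empty and the word is reduced.\<close>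

definition letter_power :: "'e \<Rightarrow> int \<Rightarrow> (bool \<times> 'e) list" where
  "letter_power x n = replicate (nat n) (True, x) @ replicate (nat (- n)) (False, x)"

lemma exponent_letter_power [simp]: "exponent (letter_power x n) = n"
  by (simp add: letter_power_def)

lemma letter_power_int:
  "letter_power x (int n) = replicate n (True, x)" "letter_power x (- int n) = replicate n (False, x)"
  by (simp_all add: letter_power_def)

lemma reduced_replicate: "reduced (replicate n a)"
proof (induction n)
  case (Suc n)
  then show ?case by (cases n) auto
qed simp

lemma letter_power_closed: "letter_power x n \<in> carrier (free_group {x})"
  by (cases "n \<ge> 0") (auto simp: letter_power_def free_group_def reduced_replicate)

text \<open>In a reduced word over a single generator adjacent letters have the same sign, so all
  letters agree.\<close>

lemma eq_letter_power:
  assumes "w \<in> carrier (free_group {x})"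
  shows "w = letter_power x (exponent w)"
proof -
  have "reduced w" "set w \<subseteq> UNIV \<times> {x}"
    using assms by (simp_all add: free_group_def)
  then show ?thesis
  proof (induction w)
    case (Cons a w)
    then have w: "w = letter_power x (exponent w)"
      using reduced_tl[OF Cons.prems(1)] by simp
    obtain b where a: "a = (b, x)"
      using Cons.prems(2) by auto
    consider "exponent w = 0" | "exponent w > 0" | "exponent w < 0"
      by linarith
    then show ?case
    proof cases
      case 1
      then show ?thesis
        using w a by (cases b) (auto simp: letter_power_def)
    next
      case 2
      \<comment> \<open>Writing the exponent as a successor exposes the first letter of
        \<open>w\<close>; reducedness then fixes the sign of \<open>a\<close>.\<close>
      define k where "k = nat (exponent w) - 1"
      have k: "exponent w = int (Suc k)"
        using 2 by (simp add: k_def)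
      have w': "w = replicate (Suc k) (True, x)"
        using w unfolding k letter_power_int by blast
      then have b
        using Cons.prems(1) a by auto
      have "exponent (a # w) = int (Suc (Suc k))"
        using k a \<open>b\<close> by simp
      then show ?thesis
        using w' a \<open>b\<close> by (simp only: letter_power_int) simp
    next
      case 3
      define k where "k = nat (- exponent w) - 1"
      have k: "exponent w = - int (Suc k)"
        using 3 by (simp add: k_def)
      have w': "w = replicate (Suc k) (False, x)"
        using w unfolding k letter_power_int by blast
      then have "\<not> b"
        using Cons.prems(1) a by auto
      have "exponent (a # w) = - int (Suc (Suc k))"
        using k a \<open>\<not> b\<close> by simp
      then show ?thesis
        using w' a \<open>\<not> b\<close> by (simp only: letter_power_int) simp
    qed
  qed (simp add: letter_power_def)
qed

section \<open>Integer degrees of words in the generators\<close>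

primrec lgen_deg :: "('v, 'e) lgen \<Rightarrow> int" where
  "lgen_deg (S e) = 1"
| "lgen_deg (Sst e) = - 1"
| "lgen_deg (P A) = 0"

definition word_deg :: "('v, 'e) lgen list \<Rightarrow> int" where
  "word_deg w = sum_list (map lgen_deg w)"

lemma word_deg_simps [simp]:
  "word_deg [] = 0" "word_deg (g # w) = lgen_deg g + word_deg w"
  "word_deg (w @ w') = word_deg w + word_deg w'"
  by (simp_all add: word_deg_def)

lemma word_deg_replicate [simp]: "word_deg (replicate n g) = int n * lgen_deg g"
  by (induction n) (simp_all add: algebra_simps)

lemma word_deg_path_word: "word_deg (path_word \<alpha>) = exponent (path_deg \<alpha>)"
proof (cases \<alpha>)
  case (Edges es)
  have "word_deg (map S es) = exponent (map (Pair True) es)"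
    by (induction es) simp_all
  with Edges show ?thesis by simp
qed simp

lemma word_deg_path_word_star: "word_deg (path_word_star \<alpha>) = - exponent (path_deg \<alpha>)"
proof (cases \<alpha>)
  case (Edges es)
  have "word_deg (map Sst (rev es)) = - exponent (map (Pair True) es)"
    by (induction es) simp_all
  with Edges show ?thesis by simp
qed simp

locale single_loop =
  fixes G :: "('v, 'e) ultragraph" and e :: 'e and v :: 'v and scalars :: "'r::comm_ring_1 itself"
  assumes G: "ultragraph G" and edges: "edges G = {e}" and rng: "rng G e = {v}"
    and src: "src G e = v" and verts: "verts G = {v}"
begin

text \<open>All of \<int> lies over the only vertex and \<open>e\<close> is the bijection
  \<open>n \<mapsto> n - 1\<close>. Thus \<open>S e\<close> and \<open>Sst e\<close> act as mutually
  inverse shifts.\<close>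

sublocale branching_system G "\<lambda>_::int. v" "\<lambda>n. Some (e, n + 1)" "\<lambda>_ n. n - 1" scalars
  by unfold_locales (auto simp: G edges rng src)

lemma gverts_cases: "B \<in> gverts G \<Longrightarrow> B = {} \<or> B = {v}"
  by (induction rule: gverts.induct) (auto simp: edges rng verts)

lemma v_in_gverts: "{v} \<in> gverts G"
  by (rule gverts.singleton) (simp add: verts)

lemma lgens_cases:
  assumes "g \<in> lgens G"
  obtains "g = S e" | "g = Sst e" | "g = P {v}" | "g = P {}"
  using assms gverts_cases by (auto simp: lgens_def edges)

lemma gens_in_lgens: "S e \<in> lgens G" "Sst e \<in> lgens G" "P {v} \<in> lgens G"
  using v_in_gverts by (auto simp: lgens_def edges)

text \<open>Every generator other than \<open>P {}\<close> shifts by its degree, and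
  \<open>P {}\<close> acts as zero; so a word acts only through its degree and the occurrence of
  \<open>P {}\<close>.\<close>

lemma foldr_gen_act:
  assumes "set w \<subseteq> lgens G"
  shows "foldr gen_act w f n = (if P {} \<in> set w then 0 else f (n + word_deg w))"
  using assms
proof (induction w arbitrary: n)
  case (Cons g w)
  from Cons.prems have "g \<in> lgens G"
    by simp
  then show ?case
    by (cases rule: lgens_cases) (use Cons in \<open>auto simp: rng algebra_simps\<close>)
qed simp

section \<open>Rewriting words to normal form\<close>

lemma cls_monom_cong:
  assumes "cls (monom u) = cls (monom u')" "set p \<subseteq> lgens G" "set q \<subseteq> lgens G"
  shows "cls (monom (p @ u @ q)) = cls (monom (p @ u' @ q))"
proof -
  have left: "monom (p @ w) - monom (p @ w') \<in> I" if "monom w - monom w' \<in> I" for w w'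
  \<comment> \<open>The empty word does not belong to the non-unital free algebra, so an empty
    context is not a multiplication and is treated apart.\<close>
  proof (cases "p = []")
    case False
    then have "monom p \<in> carrier A"
      using assms(2) by (rule monom_closed)
    with that have "monom p * (monom w - monom w') \<in> I"
      using alg_ideal.mult_l[of "monom p" A "monom w - monom w'" "lrels G"] by simp
    then show ?thesis
      by (simp add: right_diff_distrib monom_mult)
  qed (use that in simp)
  have right: "monom (w @ q) - monom (w' @ q) \<in> I" if "monom w - monom w' \<in> I" for w w'
  proof (cases "q = []")
    case False
    then have "monom q \<in> carrier A"
      using assms(3) by (rule monom_closed)
    with that have "(monom w - monom w') * monom q \<in> I"
      using alg_ideal.mult_r[of "monom q" A "monom w - monom w'" "lrels G"] by simp
    then show ?thesis
      by (simp add: left_diff_distrib monom_mult)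
  qed (use that in simp)
  show ?thesis
    using assms(1) left right by (simp add: cls_eq_iff)
qed

lemma rel_eq:
  assumes "monom u - monom w \<in> (lrels G :: (('v, 'e) lgen, 'r) fpoly set)" "set q \<subseteq> lgens G"
  shows "cls (monom (u @ q)) = cls (monom (w @ q))"
  using cls_monom_cong[of u w "[]" q] alg_ideal.gen[OF assms(1), of A] assms(2)
  by (simp add: cls_eq_iff)

lemma loop_relations:
  "monom [P {v}, P {v}] - monom [P {v}] \<in> lrels G"
  "monom [P {v}, S e] - monom [S e] \<in> lrels G"
  "monom [S e, P {v}] - monom [S e] \<in> lrels G"
  "monom [P {v}, Sst e] - monom [Sst e] \<in> lrels G"
  "monom [Sst e, P {v}] - monom [Sst e] \<in> lrels G"
  "monom [Sst e, S e] - monom [P {v}] \<in> lrels G"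
proof -
  have "monom [P {v}] * monom [P {v}] - monom [P ({v} \<inter> {v})] \<in> lrels G"
    unfolding lrels_def using v_in_gverts by blast
  then show "monom [P {v}, P {v}] - monom [P {v}] \<in> lrels G"
    by (simp add: monom_mult)
  have "monom [P {src G e}] * monom [S e] - monom [S e] \<in> lrels G"
    "monom [S e] * monom [P (rng G e)] - monom [S e] \<in> lrels G"
    "monom [P (rng G e)] * monom [Sst e] - monom [Sst e] \<in> lrels G"
    "monom [Sst e] * monom [P {src G e}] - monom [Sst e] \<in> lrels G"
    "monom [Sst e] * monom [S e] - (if e = e then monom [P (rng G e)] else 0) \<in> lrels G"
    unfolding lrels_def edges by blast+
  then show "monom [P {v}, S e] - monom [S e] \<in> lrels G"
    "monom [S e, P {v}] - monom [S e] \<in> lrels G"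
    "monom [P {v}, Sst e] - monom [Sst e] \<in> lrels G"
    "monom [Sst e, P {v}] - monom [Sst e] \<in> lrels G"
    "monom [Sst e, S e] - monom [P {v}] \<in> lrels G"
    by (simp_all add: monom_mult rng src)
qed

text \<open>As \<open>e\<close> is the only edge leaving \<open>v\<close>, the sum in the fourth
  relation has one term. Together with the third relation this makes \<open>S e\<close> and
  \<open>Sst e\<close> inverse to each other.\<close>

lemma CK_relation: "cls (monom ([S e, Sst e] @ q)) = cls (monom ([P {v}] @ q))"
  if "set q \<subseteq> lgens G"
proof -
  have loop: "{e' \<in> edges G. src G e' = v} = {e}"
    by (auto simp: edges src)
  have "monom [P {v}] - (\<Sum>e\<in>{e\<in>edges G. src G e = v}. monom [S e] * monom [Sst e])
      \<in> (lrels G :: (('v, 'e) lgen, 'r) fpoly set)"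
    unfolding lrels_def by (rule UnI2, rule CollectI, rule exI[of _ v]) (simp add: loop verts)
  then have "monom [P {v}] - monom [S e, Sst e] \<in> (lrels G :: (('v, 'e) lgen, 'r) fpoly set)"
    unfolding loop by (simp add: monom_mult)
  from rel_eq[OF this that] show ?thesis
    by simp
qed

text \<open>The monomial of exponent \<open>n\<close> in \<open>R[x, x\<inverse>]\<close>. At most
  one block is nonempty, and the final \<open>P {v}\<close> supplies a nonempty word for
  \<open>n = 0\<close>, where it is the unit.\<close>

definition nf :: "int \<Rightarrow> ('v, 'e) lgen list" where
  "nf n = replicate (nat n) (S e) @ replicate (nat (- n)) (Sst e) @ [P {v}]"

lemma nf_in_lgens: "set (nf n) \<subseteq> lgens G"
  using gens_in_lgens by (auto simp: nf_def)

lemma nf_not_Nil: "nf n \<noteq> []"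
  by (simp add: nf_def)

lemma word_deg_nf: "word_deg (nf n) = n"
  by (simp add: nf_def)

lemma nf_no_empty: "P {} \<notin> set (nf n)"
  by (auto simp: nf_def)

lemma nf_Suc: "0 \<le> n \<Longrightarrow> nf (n + 1) = S e # nf n"
  by (simp add: nf_def nat_add_distrib)

lemma nf_pred: "n \<le> 0 \<Longrightarrow> nf (n - 1) = Sst e # nf n"
proof -
  assume "n \<le> 0"
  then have "nat (- (n - 1)) = Suc (nat (- n))" "nat (n - 1) = 0" "nat n = 0"
    by linarith+
  then show ?thesis
    by (simp only: nf_def) simp
qed

lemma cls_P_nf: "cls (monom (P {v} # nf n)) = cls (monom (nf n))"
proof -
  consider "n = 0" | "n > 0" | "n < 0"
    by linarith
  then show ?thesis
  proof cases
    case 1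
    then show ?thesis
      using rel_eq[OF loop_relations(1), of "[]"] by (simp add: nf_def)
  next
    case 2
    then show ?thesis
      using rel_eq[OF loop_relations(2) nf_in_lgens, of "n - 1"] nf_Suc[of "n - 1"] by simp
  next
    case 3
    then show ?thesis
      using rel_eq[OF loop_relations(4) nf_in_lgens, of "n + 1"] nf_pred[of "n + 1"] by simp
  qed
qed

text \<open>A generator either lengthens the block in front of it or cancels against its first
  letter. Cancellation leaves a \<open>P {v}\<close>, which \<open>cls_P_nf\<close> absorbs.\<close>

lemma cls_Cons_nf:
  assumes "g \<in> lgens G" "g \<noteq> P {}"
  shows "cls (monom (g # nf n)) = cls (monom (nf (lgen_deg g + n)))"
  using assms(1)
proof (cases rule: lgens_cases)
  assume g: "g = S e"
  show ?thesis
  proof (cases "n \<ge> 0")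
    case True
    then show ?thesis
      using g nf_Suc[of n] by (simp add: add.commute)
  next
    case False
    then have "nf n = Sst e # nf (n + 1)"
      using nf_pred[of "n + 1"] by simp
    then show ?thesis
      using g CK_relation[OF nf_in_lgens, of "n + 1"] cls_P_nf[of "n + 1"]
      by (simp add: add.commute)
  qed
next
  assume g: "g = Sst e"
  show ?thesis
  proof (cases "n \<le> 0")
    case True
    then show ?thesis
      using g nf_pred[of n] by simp
  next
    case False
    then have "nf n = S e # nf (n - 1)"
      using nf_Suc[of "n - 1"] by simp
    then show ?thesis
      using g rel_eq[OF loop_relations(6) nf_in_lgens, of "n - 1"] cls_P_nf[of "n - 1"]
      by simp
  qed
qed (use assms cls_P_nf in auto)

lemma cls_monom_nf:
  assumes "w \<noteq> []" "set w \<subseteq> lgens G" "P {} \<notin> set w"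
  shows "cls (monom w) = cls (monom (nf (word_deg w)))"
  using assms
proof (induction w)
  case (Cons g w)
  then have g: "g \<in> lgens G" "g \<noteq> P {}"
    by auto
  show ?case
  proof (cases "w = []")
    case True
    \<comment> \<open>\<open>nf 0\<close> is \<open>[P {v}]\<close>, and \<open>P {v}\<close> is a
      right unit for the generators.\<close>
    have "cls (monom [g]) = cls (monom (g # nf 0))"
      using g rel_eq[OF loop_relations(1), of "[]"] rel_eq[OF loop_relations(3), of "[]"]
        rel_eq[OF loop_relations(5), of "[]"]
      by (cases rule: lgens_cases) (simp_all add: nf_def)
    then show ?thesis
      using True cls_Cons_nf[OF g, of 0] by simp
  next
    case False
    then have "cls (monom w) = cls (monom (nf (word_deg w)))"
      using Cons by simp
    then have "cls (monom (g # w)) = cls (monom (g # nf (word_deg w)))"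
      using cls_monom_cong[of w "nf (word_deg w)" "[g]" "[]"] Cons.prems by simp
    then show ?thesis
      using cls_Cons_nf[OF g, of "word_deg w"] by simp
  qed
qed simp

lemma monom_empty_in_ideal:
  assumes "set w \<subseteq> lgens G" "P {} \<in> set w"
  shows "monom w \<in> I"
proof -
  obtain p q where w: "w = p @ [P {}] @ q"
    using assms(2) by (auto simp: in_set_conv_decomp)
  have mem: "monom [P {}] \<in> I"
    by (rule alg_ideal.gen) (simp add: lrels_def)
  have "monom ([P {}] @ q) \<in> I"
  proof (cases "q = []")
    case False
    then have "monom q \<in> carrier A"
      using assms(1) w by (intro monom_closed) auto
    then show ?thesis
      using alg_ideal.mult_r[OF _ mem, of "monom q"] by (simp add: monom_mult)
  qed (use mem in simp)
  then show ?thesis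
  proof (cases "p = []")
    case False
    assume *: "monom ([P {}] @ q) \<in> I"
    from False have "monom p \<in> carrier A"
      using assms(1) w by (intro monom_closed) auto
    then show ?thesis
      using alg_ideal.mult_l[OF _ *, of "monom p"] w by (simp add: monom_mult)
  qed (use w in simp)
qed

text \<open>The coefficient of \<open>nf n\<close>: a word of degree \<open>m\<close> without
  \<open>P {}\<close> sends the indicator of \<open>n\<close> to a function whose value at 0 is the
  indicator at \<open>m\<close>.\<close>

definition coef :: "int \<Rightarrow> (('v, 'e) lgen, 'r) fpoly \<Rightarrow> 'r" where
  "coef n x = ev x (\<lambda>m. if m = n then 1 else 0) 0"

lemma coef_single:
  assumes "set w \<subseteq> lgens G"
  shows "coef n (Poly_Mapping.single (FWord w) c) =
    (if P {} \<notin> set w \<and> word_deg w = n then c else 0)"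
  using assms by (simp add: coef_def ev_single foldr_gen_act)

text \<open>This is faithfulness of the representation by shifts. Modulo \<open>I\<close> each word
  may be replaced by its normal form, and the coefficients that collect at \<open>nf n\<close> add
  up to \<open>coef n x\<close>.\<close>

lemma ideal_if_coef_zero:
  assumes x: "x \<in> carrier A" and coef: "\<And>n. coef n x = 0"
  shows "x \<in> I"
proof -
  let ?K = "Poly_Mapping.keys x" and ?c = "Poly_Mapping.lookup x"
  let ?d = "\<lambda>w. word_deg (letters w)"
  \<comment> \<open>The contribution of \<open>w\<close> after rewriting: words containing
    \<open>P {}\<close> disappear.\<close>
  let ?t = "\<lambda>w. if P {} \<in> set (letters w) then 0 else Poly_Mapping.single (FWord (nf (?d w))) (?c w)"
  have letters: "letters w \<noteq> []" "set (letters w) \<subseteq> lgens G" if "w \<in> ?K" for w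
    using x that by (simp_all add: mem_free_algebra)
  have "Poly_Mapping.single w (?c w) - ?t w \<in> I" if w: "w \<in> ?K" for w
  proof -
    have w_eq: "Poly_Mapping.single w (?c w) = scale (?c w) (monom (letters w))"
      using single_eq_scale_monom[of "letters w"] by simp
    show ?thesis
    proof (cases "P {} \<in> set (letters w)")
      case True
      then show ?thesis
        using ideal_scale[OF monom_empty_in_ideal[OF letters(2)[OF w]]] by (simp add: w_eq)
    next
      case False
      then have "monom (letters w) - monom (nf (?d w)) \<in> I"
        by (intro cls_eq_iff[THEN iffD1] cls_monom_nf letters[OF w])
      from ideal_scale[OF this, of "?c w"] show ?thesis
        using False by (simp add: w_eq single_eq_scale_monom scale_minus)
    qed
  qed
  then have "(\<Sum>w\<in>?K. Poly_Mapping.single w (?c w) - ?t w) \<in> I"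
    by (rule ideal_sum)
  moreover have "(\<Sum>w\<in>?K. ?t w) = 0"
  proof -
    have "(\<Sum>w\<in>{w \<in> ?K. ?d w = n}. ?t w) = 0" for n
    proof -
      have "(\<Sum>w\<in>{w \<in> ?K. ?d w = n}. ?t w) = (\<Sum>w\<in>{w \<in> ?K. ?d w = n}.
          Poly_Mapping.single (FWord (nf n)) (if P {} \<in> set (letters w) then 0 else ?c w))"
        by (rule sum.cong) auto
      also have "\<dots> = Poly_Mapping.single (FWord (nf n))
          (\<Sum>w\<in>{w \<in> ?K. ?d w = n}. if P {} \<in> set (letters w) then 0 else ?c w)"
        by (rule poly_mapping_eqI) (simp add: lookup_sum lookup_single when_def)
      also have "(\<Sum>w\<in>{w \<in> ?K. ?d w = n}. if P {} \<in> set (letters w) then 0 else ?c w) = coef n x"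
        unfolding coef_def ev_def
        by (rule sum.mono_neutral_cong_left) (auto simp: foldr_gen_act letters)
      finally show ?thesis
        by (simp add: coef)
    qed
    then show ?thesis
      \<comment> \<open>The whole sum is grouped by degree, and each group has just been shown to
        vanish.\<close>
      by (subst sum.image_gen[of ?K _ ?d]) simp_all
  qed
  ultimately show ?thesis
    using poly_mapping_eq_sum_single[of x] by (simp add: sum_subtractf)
qed

text \<open>Any representative may be chosen, since \<open>coef\<close> vanishes on
  \<open>I\<close>.\<close>

definition coefL :: "int \<Rightarrow> (('v, 'e) lgen, 'r) fpoly set \<Rightarrow> 'r" where
  "coefL n Y = coef n (SOME x. x \<in> Y)"

lemma coefL_cls [simp]: "coefL n (cls x) = coef n x"
proof -
  have "x \<in> cls x"
    using alg_ideal.zero[of A "lrels G"] by (simp add: mem_cls_iff)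
  then have "(SOME y. y \<in> cls x) \<in> cls x"
    by (rule someI)
  then show ?thesis
    unfolding coefL_def coef_def by (rule ev_cls)
qed

lemma coef_linear:
  "coef n 0 = 0" "coef n (x + y) = coef n x + coef n y" "coef n (x - y) = coef n x - coef n y"
  "coef n (scale c x) = c * coef n x"
  by (simp_all add: coef_def ev_zero ev_add ev_minus ev_scale)

lemma L_eqI:
  assumes "Y \<in> carrier L" "Z \<in> carrier L" "\<And>n. coefL n Y = coefL n Z"
  shows "Y = Z"
proof -
  obtain x y where x: "x \<in> carrier A" "Y = cls x" and y: "y \<in> carrier A" "Z = cls y"
    using assms(1,2) unfolding carrier_L by blast
  have "x - y \<in> carrier A"
    using free_algebra_closed(3)[OF x(1) free_algebra_closed(1)[OF y(1)]] by simp
  then have "x - y \<in> I"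
    by (rule ideal_if_coef_zero) (use assms(3) x y in \<open>simp add: coef_linear\<close>)
  then show ?thesis
    using x y by (simp add: cls_eq_iff)
qed

lemma coefL_zero: "coefL n \<zero>\<^bsub>L\<^esub> = 0"
  unfolding L_zero by (simp add: coef_linear)

lemma coefL_add:
  assumes "Y \<in> carrier L" "Z \<in> carrier L"
  shows "coefL n (Y \<oplus>\<^bsub>L\<^esub> Z) = coefL n Y + coefL n Z"
proof -
  obtain x y where "Y = cls x" "Z = cls y"
    using assms unfolding carrier_L by blast
  then show ?thesis
    by (simp add: cls_add coef_linear)
qed

sublocale L: abelian_group L
  by (rule abelian_group_L)

lemma coefL_finsum:
  assumes "finite K" "f \<in> K \<rightarrow> carrier L"
  shows "coefL n (\<Oplus>\<^bsub>L\<^esub>i\<in>K. f i) = (\<Sum>i\<in>K. coefL n (f i))"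
  using assms
proof (induction K rule: finite_induct)
  case empty
  show ?case
    by (simp only: L.finsum_empty coefL_zero sum.empty)
next
  case (insert i K)
  then have "f i \<in> carrier L" "f \<in> K \<rightarrow> carrier L" "(\<Oplus>\<^bsub>L\<^esub>i\<in>K. f i) \<in> carrier L"
    by (auto intro: L.finsum_closed)
  with insert show ?case
    by (simp add: L.finsum_insert coefL_add)
qed

definition homog :: "int \<Rightarrow> 'r \<Rightarrow> (('v, 'e) lgen, 'r) fpoly set" where
  "homog n c = cls (Poly_Mapping.single (FWord (nf n)) c)"

lemma single_nf_closed: "Poly_Mapping.single (FWord (nf n)) c \<in> carrier A"
  using nf_in_lgens nf_not_Nil by (simp add: mem_free_algebra)

lemma homog_in_L: "homog n c \<in> carrier L"
  unfolding homog_def by (rule cls_in_L[OF single_nf_closed])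

lemma coefL_homog: "coefL m (homog n c) = (if m = n then c else 0)"
  by (simp add: homog_def coef_single[OF nf_in_lgens] word_deg_nf nf_no_empty)

text \<open>Comparing coefficients avoids rewriting the concatenation of two normal forms: only its
  degree matters.\<close>

lemma homog_mult: "homog m c \<otimes>\<^bsub>L\<^esub> homog n d = homog (m + n) (c * d)"
proof (rule L_eqI)
  have eq: "homog m c \<otimes>\<^bsub>L\<^esub> homog n d = cls (Poly_Mapping.single (FWord (nf m @ nf n)) (c * d))"
    by (simp add: homog_def cls_mult single_nf_closed mult_single plus_fword_def)
  show "homog m c \<otimes>\<^bsub>L\<^esub> homog n d \<in> carrier L"
    unfolding eq by (rule cls_in_L) (use nf_in_lgens nf_not_Nil in \<open>simp add: mem_free_algebra\<close>)
  have "set (nf m @ nf n) \<subseteq> lgens G"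
    using nf_in_lgens by simp
  then show "coefL k (homog m c \<otimes>\<^bsub>L\<^esub> homog n d) = coefL k (homog (m + n) (c * d))" for k
    unfolding eq coefL_homog coefL_cls by (simp add: coef_single word_deg_nf nf_no_empty)
qed (rule homog_in_L)

section \<open>Homogeneous components and strong grading\<close>

abbreviation "F \<equiv> free_group {e}"

sublocale F: group F
  by (rule group_free_group)

lemma exponent_inj: "s \<in> carrier F \<Longrightarrow> t \<in> carrier F \<Longrightarrow> exponent s = exponent t \<longleftrightarrow> s = t"
  using eq_letter_power by metis

lemma exponent_path_quotient:
  assumes "fin_path G \<alpha>" "fin_path G \<beta>"
  shows "exponent (path_deg \<alpha> \<otimes>\<^bsub>F\<^esub> inv\<^bsub>F\<^esub> path_deg \<beta>) =
    word_deg (path_word \<alpha> @ [P B] @ path_word_star \<beta>)"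
  using path_deg_in_carrier[OF assms(2)]
  by (simp add: edges exponent_mult exponent_inv word_deg_path_word word_deg_path_word_star)

text \<open>Each component needs a spanning element that is not killed by \<open>P {}\<close>, so
  that its multiples exhaust the component.\<close>

lemma lcomp_generator:
  assumes "t \<in> carrier F"
  obtains \<alpha> \<beta> where "fin_path G \<alpha>" "fin_path G \<beta>"
    "path_deg \<alpha> \<otimes>\<^bsub>F\<^esub> inv\<^bsub>F\<^esub> path_deg \<beta> = t"
    "P {} \<notin> set (path_word \<alpha> @ [P {v}] @ path_word_star \<beta>)"
proof
  \<comment> \<open>The power of the loop read as a path; length 0 needs the vertex, because
    \<open>Edges []\<close> is not a path. The positive part of the exponent goes to \<alpha> and
    the negative part to \<beta>.\<close>
  define p where "p n = (if n = 0 then Vtx {v} else Edges (replicate n e))" for n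
  have p: "fin_path G (p n)" for n
    using v_in_gverts by (auto simp: p_def edges rng src)
  show "fin_path G (p (nat (exponent t)))" "fin_path G (p (nat (- exponent t)))"
    by (rule p)+
  have exp: "exponent (path_deg (p n)) = int n" for n
    by (simp add: p_def)
  have carrier: "path_deg (p n) \<in> carrier F" for n
    using path_deg_in_carrier[OF p] by (simp add: edges)
  have "exponent (path_deg (p (nat (exponent t))) \<otimes>\<^bsub>F\<^esub> inv\<^bsub>F\<^esub> path_deg (p (nat (- exponent t)))) = exponent t"
    by (simp add: exponent_mult exponent_inv[OF carrier] exp)
  then show "path_deg (p (nat (exponent t))) \<otimes>\<^bsub>F\<^esub> inv\<^bsub>F\<^esub> path_deg (p (nat (- exponent t))) = t"
    using exponent_inj[OF F.m_closed[OF carrier F.inv_closed[OF carrier]] assms] by blast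
  show "P {} \<notin> set (path_word (p (nat (exponent t))) @ [P {v}] @ path_word_star (p (nat (- exponent t))))"
    by (auto simp: p_def)
qed

lemma lcomp_eq:
  assumes t: "t \<in> carrier F"
  shows "lcomp G t = range (homog (exponent t))"
proof (intro equalityI subsetI)
  let ?M = "{lmonom G (path_word \<alpha> @ [P A] @ path_word_star \<beta>) | \<alpha> A \<beta>.
      fin_path G \<alpha> \<and> A \<in> gverts G \<and> fin_path G \<beta> \<and>
      path_deg \<alpha> \<otimes>\<^bsub>F\<^esub> inv\<^bsub>F\<^esub> path_deg \<beta> = t} :: (('v, 'e) lgen, 'r) fpoly set set"
  have lcomp: "lcomp G t = lspan L ?M"
    by (simp add: lcomp_def leavitt_eq edges)
  {
    fix Y :: "(('v, 'e) lgen, 'r) fpoly set" assume Y: "Y \<in> lcomp G t"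
    then have "Y \<in> lspan L ?M"
      by (simp only: lcomp)
    \<comment> \<open>All spanning elements have degree \<open>exponent t\<close> as words, so no
      other coefficient can occur in their span.\<close>
    then have "\<forall>m. m \<noteq> exponent t \<longrightarrow> coefL m Y = 0"
    proof induction
      case zero
      show ?case
        by (simp only: coefL_zero) simp
    next
      case (add m Y c)
      from add(1) obtain \<alpha> B \<beta> where \<alpha>: "fin_path G \<alpha>" "B \<in> gverts G" "fin_path G \<beta>"
        and w: "path_deg \<alpha> \<otimes>\<^bsub>F\<^esub> inv\<^bsub>F\<^esub> path_deg \<beta> = t"
          "m = cls (monom (path_word \<alpha> @ [P B] @ path_word_star \<beta>))"
        unfolding lmonom_eq by blast
      have "Y \<in> carrier L"
        using add(2) lcomp_in_carrier lcomp by blast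
      then obtain y where y: "Y = cls y"
        unfolding carrier_L by blast
      have "coefL k m = 0" if "k \<noteq> exponent t" for k
        using that exponent_path_quotient[OF \<alpha>(1,3), of B] w
        by (simp only: w(2) monom_def coefL_cls coef_single[OF word_in_lgens[OF \<alpha>]]) simp
      then show ?case
        using add.IH y w(2) by (simp add: cls_scale cls_add coef_linear)
    qed
    then have "Y = homog (exponent t) (coefL (exponent t) Y)"
      using lcomp_in_carrier Y homog_in_L by (intro L_eqI) (auto simp: coefL_homog)
    then show "Y \<in> range (homog (exponent t))"
      by blast
  next
    fix Y assume "Y \<in> range (homog (exponent t))"
    then obtain c where c: "Y = homog (exponent t) c"
      by blast
    obtain \<alpha> \<beta> where \<alpha>: "fin_path G \<alpha>" "fin_path G \<beta>"
      and w: "path_deg \<alpha> \<otimes>\<^bsub>F\<^esub> inv\<^bsub>F\<^esub> path_deg \<beta> = t"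
        "P {} \<notin> set (path_word \<alpha> @ [P {v}] @ path_word_star \<beta>)"
      using lcomp_generator[OF t] .
    let ?w = "path_word \<alpha> @ [P {v}] @ path_word_star \<beta>"
    have "lmonom G ?w \<in> ?M"
      using \<alpha> w v_in_gverts by blast
    then have mem: "c \<odot>\<^bsub>L\<^esub> lmonom G ?w \<oplus>\<^bsub>L\<^esub> \<zero>\<^bsub>L\<^esub> \<in> lspan L ?M"
      by (intro lspan.intros)
    moreover have "c \<odot>\<^bsub>L\<^esub> lmonom G ?w \<oplus>\<^bsub>L\<^esub> \<zero>\<^bsub>L\<^esub> = Y"
    proof (rule L_eqI)
      have eq: "c \<odot>\<^bsub>L\<^esub> lmonom G ?w \<oplus>\<^bsub>L\<^esub> \<zero>\<^bsub>L\<^esub> = cls (scale c (monom ?w))"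
        by (simp only: lmonom_eq cls_scale cls_add L_zero) simp
      show "coefL n (c \<odot>\<^bsub>L\<^esub> lmonom G ?w \<oplus>\<^bsub>L\<^esub> \<zero>\<^bsub>L\<^esub>) = coefL n Y" for n
        using exponent_path_quotient[OF \<alpha>, of "{v}"] w
        unfolding eq c coefL_homog coefL_cls coef_linear monom_def
          coef_single[OF word_in_lgens[OF \<alpha>(1) v_in_gverts \<alpha>(2)]]
        by simp
    next
      show "c \<odot>\<^bsub>L\<^esub> lmonom G ?w \<oplus>\<^bsub>L\<^esub> \<zero>\<^bsub>L\<^esub> \<in> carrier L"
        using mem lcomp_in_carrier lcomp by blast
      show "Y \<in> carrier L"
        unfolding c by (rule homog_in_L)
    qed
    ultimately show "Y \<in> lcomp G t"
      by (simp only: lcomp)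
  }
qed

lemma homog_zero: "homog n 0 = \<zero>\<^bsub>L\<^esub>"
  unfolding homog_def L_zero by simp

lemma homog_add: "homog n c \<oplus>\<^bsub>L\<^esub> homog n d = homog n (c + d)"
  unfolding homog_def cls_add by (simp add: single_add)

lemma additive_subgroup_lcomp:
  assumes "t \<in> carrier F"
  shows "additive_subgroup (lcomp G t) L"
proof (intro additive_subgroup.intro group.subgroupI L.a_group)
  have "\<ominus>\<^bsub>L\<^esub> homog n c = homog n (- c)" for n c
    using homog_in_L by (intro L.minus_equality) (simp_all add: homog_add homog_zero)
  then show "Y \<in> lcomp G t \<Longrightarrow> inv\<^bsub>add_monoid L\<^esub> Y \<in> lcomp G t" for Y
    unfolding lcomp_eq[OF assms] by (auto simp: a_inv_def)
  show "Y \<in> lcomp G t \<Longrightarrow> Z \<in> lcomp G t \<Longrightarrow> Y \<otimes>\<^bsub>add_monoid L\<^esub> Z \<in> lcomp G t" for Y Z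
    unfolding lcomp_eq[OF assms] by (auto simp: homog_add)
  show "lcomp G t \<subseteq> carrier (add_monoid L)"
    using lcomp_in_carrier by simp
  show "lcomp G t \<noteq> ({} :: (('v, 'e) lgen, 'r) fpoly set set)"
    unfolding lcomp_eq[OF assms] by simp
qed

lemma sum_prods_lcomp:
  assumes "g \<in> carrier F" "h \<in> carrier F"
  shows "sum_prods L (lcomp G g) (lcomp G h) = lcomp G (g \<otimes>\<^bsub>F\<^esub> h)"
proof -
  have gh: "lcomp G (g \<otimes>\<^bsub>F\<^esub> h) = range (homog (exponent g + exponent h))"
    using assms by (simp add: lcomp_eq exponent_mult)
  show ?thesis
    unfolding gh lcomp_eq[OF assms(1)] lcomp_eq[OF assms(2)]
  proof (intro equalityI subsetI)
    fix Y assume "Y \<in> sum_prods L (range (homog (exponent g))) (range (homog (exponent h)))"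
    then show "Y \<in> range (homog (exponent g + exponent h))"
    proof induction
      case zero
      show ?case
        using homog_zero by (metis rangeI)
    qed (auto simp: homog_mult homog_add)
  next
    fix Y assume "Y \<in> range (homog (exponent g + exponent h))"
    then obtain c where Y: "Y = homog (exponent g + exponent h) c"
      by blast
    \<comment> \<open>The whole scalar goes into the left factor, and the right factor is the
      monomial with coefficient 1.\<close>
    have "homog (exponent g) c \<otimes>\<^bsub>L\<^esub> homog (exponent h) 1 \<oplus>\<^bsub>L\<^esub> \<zero>\<^bsub>L\<^esub>
        \<in> sum_prods L (range (homog (exponent g))) (range (homog (exponent h)))"
      by (intro sum_prods.intros rangeI)
    moreover have "homog (exponent g) c \<otimes>\<^bsub>L\<^esub> homog (exponent h) 1 \<oplus>\<^bsub>L\<^esub> \<zero>\<^bsub>L\<^esub> = Y"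
      unfolding homog_mult Y by (simp add: homog_in_L)
    ultimately show "Y \<in> sum_prods L (range (homog (exponent g))) (range (homog (exponent h)))"
      by simp
  qed
qed

text \<open>Only degrees of words in the support of one representative can occur.\<close>

lemma finite_coefL: "Y \<in> carrier L \<Longrightarrow> finite {n. coefL n Y \<noteq> 0}"
proof -
  assume "Y \<in> carrier L"
  then obtain x where x: "x \<in> carrier A" "Y = cls x"
    unfolding carrier_L by blast
  have "{n. coefL n Y \<noteq> 0} \<subseteq> (\<lambda>w. word_deg (letters w)) ` Poly_Mapping.keys x"
  proof
    fix n assume "n \<in> {n. coefL n Y \<noteq> 0}"
    then have "ev x (\<lambda>m. if m = n then 1 else 0) 0 \<noteq> 0"
      using x by (simp add: coef_def)
    then obtain w where "w \<in> Poly_Mapping.keys x"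
      "foldr gen_act (letters w) (\<lambda>m. if m = n then 1 else 0) 0 \<noteq> 0"
      unfolding ev_def by (metis (no_types, lifting) mult_zero_right sum.neutral)
    then show "n \<in> (\<lambda>w. word_deg (letters w)) ` Poly_Mapping.keys x"
      using x(1) by (auto simp: mem_free_algebra foldr_gen_act split: if_splits)
  qed
  then show "finite {n. coefL n Y \<noteq> 0}"
    by (rule finite_subset) simp
qed

text \<open>Existence and uniqueness of the homogeneous decomposition at once: each exponent belongs
  to exactly one group element, so the summands are dictated by the coefficients of
  \<open>Y\<close>.\<close>

lemma decomposition_iff:
  assumes Y: "Y \<in> carrier L"
  shows "f \<in> (\<Pi>\<^sub>E g\<in>carrier F. lcomp G g) \<and> finite {g\<in>carrier F. f g \<noteq> \<zero>\<^bsub>L\<^esub>} \<and>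
      Y = (\<Oplus>\<^bsub>L\<^esub>g\<in>{g\<in>carrier F. f g \<noteq> \<zero>\<^bsub>L\<^esub>}. f g) \<longleftrightarrow>
    f = (\<lambda>t\<in>carrier F. homog (exponent t) (coefL (exponent t) Y))"
    (is "?lhs \<longleftrightarrow> f = ?f")
proof -
  have coef_sum: "coefL n (\<Oplus>\<^bsub>L\<^esub>g\<in>{g\<in>carrier F. f g \<noteq> \<zero>\<^bsub>L\<^esub>}. f g) = coefL n (f (letter_power e n))"
    if f: "f \<in> (\<Pi>\<^sub>E g\<in>carrier F. lcomp G g)" "finite {g\<in>carrier F. f g \<noteq> \<zero>\<^bsub>L\<^esub>}" for n f
  proof -
    let ?D = "{g\<in>carrier F. f g \<noteq> \<zero>\<^bsub>L\<^esub>}"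
    have in_L: "f \<in> ?D \<rightarrow> carrier L"
      using f(1) lcomp_in_carrier by fastforce
    \<comment> \<open>Each summand has its only possible coefficient at its own exponent, so the
      power of \<open>e\<close> with exponent \<open>n\<close> alone contributes.\<close>
    have "coefL n (f g) = (if g = letter_power e n then coefL n (f (letter_power e n)) else 0)"
      if g: "g \<in> carrier F" for g
    proof -
      obtain c where "f g = homog (exponent g) c"
        using PiE_mem[OF f(1) g] unfolding lcomp_eq[OF g] by (rule rangeE)
      then show ?thesis
        using eq_letter_power[OF g] by (auto simp: coefL_homog)
    qed
    then have "coefL n (\<Oplus>\<^bsub>L\<^esub>g\<in>?D. f g) =
        (\<Sum>g\<in>?D. if g = letter_power e n then coefL n (f (letter_power e n)) else 0)"
      unfolding coefL_finsum[OF f(2) in_L] by (intro sum.cong) auto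
    also have "\<dots> = (if letter_power e n \<in> ?D then coefL n (f (letter_power e n)) else 0)"
      using f(2) by (rule sum.delta)
    also have "\<dots> = coefL n (f (letter_power e n))"
      using letter_power_closed[of e n] coefL_zero[of n] by auto
    finally show ?thesis .
  qed
  show ?thesis
  proof
    assume lhs: ?lhs
    have coef: "coefL (exponent t) (f t) = coefL (exponent t) Y" if "t \<in> carrier F" for t
      using coef_sum[of f "exponent t"] lhs eq_letter_power[OF that] by metis
    show "f = ?f"
    proof (rule extensionalityI[of _ "carrier F"])
      fix t assume t: "t \<in> carrier F"
      obtain c where c: "f t = homog (exponent t) c"
        using PiE_mem[OF conjunct1[OF lhs] t] unfolding lcomp_eq[OF t] by (rule rangeE)
      then show "f t = ?f t"
        using coef[OF t] t by (simp add: coefL_homog)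
    qed (use lhs in \<open>auto simp: PiE_def\<close>)
  next
    assume f: "f = ?f"
    have Pi: "f \<in> (\<Pi>\<^sub>E g\<in>carrier F. lcomp G g)"
      unfolding f by (rule restrict_PiE_iff[THEN iffD2]) (simp add: lcomp_eq)
    have "{g\<in>carrier F. f g \<noteq> \<zero>\<^bsub>L\<^esub>} \<subseteq> letter_power e ` {n. coefL n Y \<noteq> 0}"
    proof
      fix t assume "t \<in> {g\<in>carrier F. f g \<noteq> \<zero>\<^bsub>L\<^esub>}"
      then have "t \<in> carrier F" "coefL (exponent t) Y \<noteq> 0"
        unfolding f using homog_zero by auto
      then show "t \<in> letter_power e ` {n. coefL n Y \<noteq> 0}"
        by (intro image_eqI[of _ _ "exponent t"] eq_letter_power) simp_all
    qed
    then have fin: "finite {g\<in>carrier F. f g \<noteq> \<zero>\<^bsub>L\<^esub>}"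
      by (rule finite_surj[OF finite_coefL[OF Y]])
    have "Y = (\<Oplus>\<^bsub>L\<^esub>g\<in>{g\<in>carrier F. f g \<noteq> \<zero>\<^bsub>L\<^esub>}. f g)"
    proof (rule L_eqI[OF Y])
      show "(\<Oplus>\<^bsub>L\<^esub>g\<in>{g\<in>carrier F. f g \<noteq> \<zero>\<^bsub>L\<^esub>}. f g) \<in> carrier L"
        using Pi lcomp_in_carrier by (intro L.finsum_closed) fastforce
      show "coefL n Y = coefL n (\<Oplus>\<^bsub>L\<^esub>g\<in>{g\<in>carrier F. f g \<noteq> \<zero>\<^bsub>L\<^esub>}. f g)" for n
      proof -
        have "coefL n (f (letter_power e n)) = coefL n Y"
          unfolding f by (simp add: letter_power_closed coefL_homog)
        then show ?thesis
          by (simp only: coef_sum[OF Pi fin])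
      qed
    qed
    with Pi fin show ?lhs
      by blast
  qed
qed

theorem strongly_graded_loop:
  "strongly_graded (free_group (edges G)) (leavitt G :: ('v, 'e, 'r) lpa) (lcomp G)"
  unfolding strongly_graded_def graded_def edges leavitt_eq decomposition_iff
  using additive_subgroup_lcomp sum_prods_lcomp by (auto simp: decomposition_iff)

end

text \<open>The clause on vertices excludes isolated ones. The projection at an isolated vertex is a
  nonzero element of neutral degree, but it is not in the product of the components of
  \<open>e\<close> and its inverse.\<close>

theorem theorem6p3:
  fixes G :: "('v, 'e) ultragraph"
  assumes "ultragraph G" and "edges G \<noteq> {}"
  shows "strongly_graded (free_group (edges G)) (leavitt G :: ('v, 'e, 'r::comm_ring_1) lpa) (lcomp G)
    \<longleftrightarrow> (\<exists>e. edges G = {e} \<and> rng G e = {src G e}) \<and>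
        (\<forall>v\<in>verts G. \<exists>e\<in>edges G. v = src G e \<or> v \<in> rng G e)"
    (is "?strong \<longleftrightarrow> ?loop")
proof
  assume ?strong
  then obtain e where e: "edges G = {e}" "verts G = {src G e}"
    using strongly_graded_imp_one_edge[OF assms] by blast
  moreover have "rng G e \<subseteq> verts G" "rng G e \<noteq> {}"
    using assms(1) e(1) by (auto simp: ultragraph_def)
  ultimately show ?loop
    by auto
next
  assume ?loop
  then obtain e where e: "edges G = {e}" "rng G e = {src G e}"
    by blast
  \<comment> \<open>Every vertex is the source of \<open>e\<close> or lies in its range, and both
    cases give \<open>src G e\<close>.\<close>
  moreover have "verts G = {src G e}"
    using \<open>?loop\<close> e assms(1) by (auto simp: ultragraph_def)
  ultimately interpret single_loop G e "src G e" "TYPE('r)"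
    using assms(1) by unfold_locales simp_all
  show ?strong
    by (rule strongly_graded_loop)
qed

end
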